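(* Let $(X,G)$ be a minimal topological dynamical system, where $G$ is amenable, and assume $(X,G)$ satisfies the local Bronstein condition. Then: (i) There exists a dense $G_\delta$ subset $Z\subset X_{eq}$ with $\nu_{eq}(Z)=1$ such that $\pi_{eq}^{-1}(y)$ is a weakly mean-sensitive set for every $y\in Z$. (ii) If $K\in\mathbb N$ and $\pi_{eq}$ is regular $K$ to one, then $(X,G)$ has essential weakly mean-sensitive $K$-tuples but has no essential weakly mean-sensitive $(K+1)$-tuples. (iii) Every weakly mean-sensitive set is an IT-set.
   Context: $G$ is an infinite countable discrete group. A tds $(X,G)$ is a compact metric space $(X,d)$ with a $G$-action by homeomorphisms; minimal means no proper nonempty closed invariant subset; a minimal point is one whose orbit closure is minimal. $\pi_{eq}:X\to X_{eq}$ is the factor map onto the maximal equicontinuous factor; for minimal $(X,G)$, $(X_{eq},G)$ is uniquely ergodic with invariant measure $\nu_{eq}$. $\pi_{eq}$ is regular $K$ to one if $\nu_{eq}(\{y:|\pi_{eq}^{-1}(y)|=K\})=1$. $RP_2(X,G)$ is the set of $(x_1,x_2)$ such that for every $\epsilon>0$ there are $x_1',x_2'$ and $g\in G$ with $d(x_k,x_k')\le\epsilon$ and $d(gx_1',gx_2')\le\epsilon$. Local Bronstein condition: whenever $(x,x')\in RP_2(X,G)$ is a minimal point of $(X\times X,G)$, there exist minimal points $(x_n,x_n')$ of $(X\times X,G)$ and $g_n\in G$ with $(x_n,x_n')\to(x,x')$ and $d(g_nx_n,g_nx_n')\to0$. For $F\subset G$ with $G$ amenable, $\overline{BD}(F)=\max_{\{F_n\}}\limsup_n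 |F_n\cap F|/|F_n|$ over all Følner sequences $\{F_n\}$ of $G$. A tuple $(x_1,\dots,x_K)\in X^K$ is a weakly mean-sensitive $K$-tuple if for all open neighborhoods $U_k$ of $x_k$ there is $\delta>0$ such that for every nonempty open $U\subset X$, $\overline{BD}(\{g\in G: gU\cap U_k\neq\emptyset \text{ for } 1\le k\le K\})>\delta$. It is essential if its entries are pairwise distinct. A weakly mean-sensitive set is a set such that every tuple of its points is weakly mean-sensitive. Independence set for $(A_1,\dots,A_K)$: $J\subset G$ with $\bigcap_{g\in I}g^{-1}A_{\sigma(g)}\neq\emptyset$ for all nonempty finite $I\subset J$ and $\sigma:I\to\{1,\dots,K\}$. A $K$-IT-tuple is $(x_1,\dots,x_K)$ such that for all open neighborhoods $U_k\ni x_k$, $(U_1,\dots,U_K)$ has an infinite independence set; an IT-set is a nonempty set all of whose tuples are IT-tuples. *)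

theory Defs
  imports "HOL-Analysis.Analysis" "HOL-Probability.Probability"
begin

text \<open>Groups are written additively (type class group_add, not necessarily commutative):
  the identity is 0, the product g h is g + h, and g^{-1} is - g.\<close>

definition is_action :: "('g::group_add \<Rightarrow> 'x::topological_space \<Rightarrow> 'x) \<Rightarrow> bool" where
  "is_action act \<longleftrightarrow> act 0 = id \<and> (\<forall>g h. act (g + h) = act g \<circ> act h)
     \<and> (\<forall>g. continuous_on UNIV (act g))"

definition tds :: "('g::group_add \<Rightarrow> 'x::metric_space \<Rightarrow> 'x) \<Rightarrow> bool" where
  "tds act \<longleftrightarrow> compact (UNIV::'x set) \<and> countable (UNIV::'g set) \<and> infinite (UNIV::'g set)
     \<and> is_action act"

definition invariant_set :: "('g \<Rightarrow> 'a \<Rightarrow> 'a) \<Rightarrow> 'a set \<Rightarrow> bool" where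
  "invariant_set act S \<longleftrightarrow> (\<forall>g. act g ` S \<subseteq> S)"

definition minimal_set :: "('g \<Rightarrow> 'a::topological_space \<Rightarrow> 'a) \<Rightarrow> 'a set \<Rightarrow> bool" where
  "minimal_set act S \<longleftrightarrow> S \<noteq> {} \<and> closed S \<and> invariant_set act S \<and>
     (\<forall>T. T \<noteq> {} \<and> closed T \<and> T \<subseteq> S \<and> invariant_set act T \<longrightarrow> T = S)"

definition minimal_system :: "('g \<Rightarrow> 'a::topological_space \<Rightarrow> 'a) \<Rightarrow> bool" where
  "minimal_system act \<longleftrightarrow> minimal_set act UNIV"

definition minimal_point :: "('g \<Rightarrow> 'a::topological_space \<Rightarrow> 'a) \<Rightarrow> 'a \<Rightarrow> bool" where
  "minimal_point act x \<longleftrightarrow> minimal_set act (closure (range (\<lambda>g. act g x)))"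

definition prod_act :: "('g \<Rightarrow> 'x \<Rightarrow> 'x) \<Rightarrow> 'g \<Rightarrow> 'x \<times> 'x \<Rightarrow> 'x \<times> 'x" where
  "prod_act act g p = (act g (fst p), act g (snd p))"

definition RP2 :: "('g \<Rightarrow> 'x::metric_space \<Rightarrow> 'x) \<Rightarrow> ('x \<times> 'x) set" where
  "RP2 act = {(x1, x2). \<forall>\<epsilon>>0. \<exists>x1' x2' g. dist x1 x1' \<le> \<epsilon> \<and> dist x2 x2' \<le> \<epsilon>
       \<and> dist (act g x1') (act g x2') \<le> \<epsilon>}"

definition local_Bronstein :: "('g \<Rightarrow> 'x::metric_space \<Rightarrow> 'x) \<Rightarrow> bool" where
  "local_Bronstein act \<longleftrightarrow>
     (\<forall>x x'. (x, x') \<in> RP2 act \<and> minimal_point (prod_act act) (x, x') \<longrightarrow>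
        (\<exists>(p :: nat \<Rightarrow> 'x \<times> 'x) (gs :: nat \<Rightarrow> 'g).
            (\<forall>n. minimal_point (prod_act act) (p n)) \<and> p \<longlonglongrightarrow> (x, x') \<and>
            (\<lambda>n. dist (act (gs n) (fst (p n))) (act (gs n) (snd (p n)))) \<longlonglongrightarrow> 0))"

definition equicontinuous_on :: "'a::metric_space set \<Rightarrow> ('g \<Rightarrow> 'a \<Rightarrow> 'a) \<Rightarrow> bool" where
  "equicontinuous_on Y b \<longleftrightarrow> (\<forall>\<epsilon>>0. \<exists>\<delta>>0. \<forall>y\<in>Y. \<forall>y'\<in>Y.
      dist y y' < \<delta> \<longrightarrow> (\<forall>g. dist (b g y) (b g y') < \<epsilon>))"

definition factor_map :: "('g::group_add \<Rightarrow> 'x::metric_space \<Rightarrow> 'x) \<Rightarrow> ('g \<Rightarrow> 'y::metric_space \<Rightarrow> 'y)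
     \<Rightarrow> ('x \<Rightarrow> 'y) \<Rightarrow> bool" where
  "factor_map act act' \<pi> \<longleftrightarrow> is_action act' \<and> continuous_on UNIV \<pi> \<and> surj \<pi> \<and>
     (\<forall>g x. \<pi> (act g x) = act' g (\<pi> x))"

text \<open>Maximal equicontinuous factor.  Maximality is quantified over all equicontinuous
  factors realised inside the Hilbert-cube-like metric space nat => real (every compact
  metric space embeds there; equicontinuity on a compact space does not depend on the
  compatible metric).\<close>
definition max_eq_factor :: "('g::group_add \<Rightarrow> 'x::metric_space \<Rightarrow> 'x) \<Rightarrow> ('g \<Rightarrow> 'y::metric_space \<Rightarrow> 'y)
     \<Rightarrow> ('x \<Rightarrow> 'y) \<Rightarrow> bool" where
  "max_eq_factor act act' \<pi> \<longleftrightarrow> factor_map act act' \<pi> \<and> equicontinuous_on UNIV act' \<and>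
     (\<forall>(p :: 'x \<Rightarrow> nat \<Rightarrow> real) (b :: 'g \<Rightarrow> (nat \<Rightarrow> real) \<Rightarrow> (nat \<Rightarrow> real)).
        continuous_on UNIV p \<and> (\<forall>g. continuous_on (range p) (b g)) \<and>
        (\<forall>g x. p (act g x) = b g (p x)) \<and> equicontinuous_on (range p) b
        \<longrightarrow> (\<exists>f. continuous_on UNIV f \<and> (\<forall>x. p x = f (\<pi> x))))"

definition invariant_prob :: "('g \<Rightarrow> 'y::topological_space \<Rightarrow> 'y) \<Rightarrow> 'y measure \<Rightarrow> bool" where
  "invariant_prob act' M \<longleftrightarrow> prob_space M \<and> sets M = sets borel \<and>
     (\<forall>g A. A \<in> sets borel \<longrightarrow> emeasure M (act' g -` A) = emeasure M A)"

definition regular_K_to_one :: "('x \<Rightarrow> 'y) \<Rightarrow> 'y measure \<Rightarrow> nat \<Rightarrow> bool" where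
  "regular_K_to_one \<pi> M K \<longleftrightarrow>
     {y. finite (\<pi> -` {y}) \<and> card (\<pi> -` {y}) = K} \<in> sets M \<and>
     emeasure M {y. finite (\<pi> -` {y}) \<and> card (\<pi> -` {y}) = K} = 1"

definition folner :: "(nat \<Rightarrow> 'g::group_add set) \<Rightarrow> bool" where
  "folner F \<longleftrightarrow> (\<forall>n. finite (F n) \<and> F n \<noteq> {}) \<and>
     (\<forall>g. (\<lambda>n. real (card (((+) g ` F n) - F n \<union> (F n - (+) g ` F n))) / real (card (F n)))
           \<longlonglongrightarrow> 0)"

definition amenable :: "'g::group_add itself \<Rightarrow> bool" where
  "amenable _ \<longleftrightarrow> (\<exists>F :: nat \<Rightarrow> 'g set. folner F)"

definition upper_BD :: "'g::group_add set \<Rightarrow> ereal" where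
  "upper_BD S = (SUP F \<in> {F. folner F}.
      limsup (\<lambda>n. ereal (real (card (F n \<inter> S)) / real (card (F n)))))"

text \<open>Tuples (x_1,...,x_K) are represented as functions on {..<K}.\<close>
definition wms_tuple :: "('g::group_add \<Rightarrow> 'x::topological_space \<Rightarrow> 'x) \<Rightarrow> nat \<Rightarrow> (nat \<Rightarrow> 'x) \<Rightarrow> bool" where
  "wms_tuple act K xs \<longleftrightarrow>
     (\<forall>U :: nat \<Rightarrow> 'x set. (\<forall>k<K. open (U k) \<and> xs k \<in> U k) \<longrightarrow>
        (\<exists>\<delta>::real>0. \<forall>V. open V \<and> V \<noteq> {} \<longrightarrow>
            upper_BD {g. \<forall>k<K. act g ` V \<inter> U k \<noteq> {}} > ereal \<delta>))"

definition essential :: "nat \<Rightarrow> (nat \<Rightarrow> 'x) \<Rightarrow> bool" where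
  "essential K xs \<longleftrightarrow> inj_on xs {..<K}"

definition wms_set :: "('g::group_add \<Rightarrow> 'x::topological_space \<Rightarrow> 'x) \<Rightarrow> 'x set \<Rightarrow> bool" where
  "wms_set act A \<longleftrightarrow> (\<forall>K xs. (\<forall>k<K. xs k \<in> A) \<longrightarrow> wms_tuple act K xs)"

definition independence_set :: "('g \<Rightarrow> 'x \<Rightarrow> 'x) \<Rightarrow> nat \<Rightarrow> (nat \<Rightarrow> 'x set) \<Rightarrow> 'g set \<Rightarrow> bool" where
  "independence_set act K A J \<longleftrightarrow>
     (\<forall>I \<sigma>. I \<subseteq> J \<and> finite I \<and> I \<noteq> {} \<and> (\<forall>g\<in>I. \<sigma> g < K) \<longrightarrow>
        (\<Inter>g\<in>I. act g -` A (\<sigma> g)) \<noteq> {})"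

definition IT_tuple :: "('g \<Rightarrow> 'x::topological_space \<Rightarrow> 'x) \<Rightarrow> nat \<Rightarrow> (nat \<Rightarrow> 'x) \<Rightarrow> bool" where
  "IT_tuple act K xs \<longleftrightarrow>
     (\<forall>U :: nat \<Rightarrow> 'x set. (\<forall>k<K. open (U k) \<and> xs k \<in> U k) \<longrightarrow>
        (\<exists>J. infinite J \<and> independence_set act K U J))"

definition IT_set :: "('g \<Rightarrow> 'x::topological_space \<Rightarrow> 'x) \<Rightarrow> 'x set \<Rightarrow> bool" where
  "IT_set act A \<longleftrightarrow> A \<noteq> {} \<and> (\<forall>K xs. (\<forall>k<K. xs k \<in> A) \<longrightarrow> IT_tuple act K xs)"

end

theory Submission
  imports Defs
begin

text \<open>
  The factor action is isometric for \<open>\<rho>(y, y') = sup\<^sub>g d(gy, gy')\<close>. An invariant mean on the group gives a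
  finitely additive invariant content on the powers of the space that is positive on open boxes, and McMahon's
  argument with this content shows: if \<open>x\<close>, \<open>x'\<close> lie in one fibre of \<open>\<pi>\<close>, then some \<open>g\<close> moves a
  neighbourhood of \<open>x\<close> to meet a neighbourhood of \<open>x'\<close> while returning any finite number of given open sets to
  themselves. Iterating, some translate of a given open set meets finitely many open sets that all meet one fibre.

  (i) Off countably many null sets, neighbourhoods \<open>U\<^sub>k\<close> of points of a fibre have \<open>\<nu>(\<Inter>\<^sub>k \<pi>(U\<^sub>k)) > 0\<close>. For each
  Folner set \<open>F\<^sub>n\<close> some \<open>z\<close> visits this intersection with at least that frequency along \<open>F\<^sub>n\<close>, and the hitting
  property over the fibre of \<open>z\<close> turns this into a lower bound along a right translate of \<open>F\<^sub>n\<close>.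

  (ii) Conversely, equicontinuity and unique ergodicity of the factor bound the density in the definition of
  weak mean-sensitivity by \<open>\<nu>(\<Inter>\<^sub>k \<pi>(U\<^sub>k))\<close> with closed neighbourhoods \<open>U\<^sub>k\<close>; this vanishes for \<open>K + 1\<close>
  disjoint neighbourhoods when almost all fibres have \<open>K\<close> points.

  (iii) By the same bound \<open>A = \<Inter>\<^sub>k \<pi>(U\<^sub>k)\<close> has positive measure. An independence set grows one element at a time:
  a new element has to move one base point for each of the exponentially many patterns close to \<open>A\<close>. The
  base points of refined patterns are chosen so close to the old ones that the density of such group
  elements stays positive.
\<close>

section \<open>Folner averages and invariant means\<close>

definition favg :: "'g set \<Rightarrow> ('g \<Rightarrow> real) \<Rightarrow> real" where
  "favg F \<phi> = (\<Sum>g\<in>F. \<phi> g) / real (card F)"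

lemma favg_add: "favg F (\<lambda>g. \<phi> g + \<psi> g) = favg F \<phi> + favg F \<psi>"
  by (simp add: favg_def sum.distrib add_divide_distrib)

lemma favg_diff: "favg F (\<lambda>g. \<phi> g - \<psi> g) = favg F \<phi> - favg F \<psi>"
  by (simp add: favg_def sum_subtractf diff_divide_distrib)

lemma favg_cmult: "favg F (\<lambda>g. c * \<phi> g) = c * favg F \<phi>"
  by (simp add: favg_def sum_distrib_left)

lemma favg_mono: "(\<And>g. g \<in> F \<Longrightarrow> \<phi> g \<le> \<psi> g) \<Longrightarrow> favg F \<phi> \<le> favg F \<psi>"
  by (simp add: favg_def sum_mono divide_right_mono)

lemma favg_const: "finite F \<Longrightarrow> F \<noteq> {} \<Longrightarrow> favg F (\<lambda>_. c) = c"
  by (simp add: favg_def)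

lemma favg_abs_le:
  assumes "finite F" "F \<noteq> {}" "\<And>g. g \<in> F \<Longrightarrow> \<bar>\<phi> g\<bar> \<le> B"
  shows "\<bar>favg F \<phi>\<bar> \<le> B"
proof -
  have "favg F (\<lambda>_. - B) \<le> favg F \<phi>" "favg F \<phi> \<le> favg F (\<lambda>_. B)"
    using assms(3) by (intro favg_mono; force simp: abs_le_iff)+
  then show ?thesis
    using assms(1,2) by (simp add: favg_const abs_le_iff)
qed

lemma favg_indicator: "finite F \<Longrightarrow> favg F (indicator S) = real (card (F \<inter> S)) / real (card F)"
  by (simp add: favg_def indicator_def sum.If_cases)

lemma favg_swap: "favg F (\<lambda>g. favg H (\<lambda>h. \<phi> g h)) = favg H (\<lambda>h. favg F (\<lambda>g. \<phi> g h))"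
  by (simp add: favg_def sum_divide_distrib[symmetric] sum.swap[of _ F H])

lemma favg_image: "inj_on f F \<Longrightarrow> favg (f ` F) \<phi> = favg F (\<lambda>g. \<phi> (f g))"
  by (simp add: favg_def sum.reindex card_image)

text \<open>The sums over \<open>F\<close> and over its translate by \<open>h\<close> cancel on the
  common part, so only the symmetric difference contributes, each term by at most
  \<open>B\<close>.\<close>

lemma favg_translate:
  fixes F :: "'g::group_add set"
  assumes F: "finite F" and B: "\<And>g. \<bar>\<phi> g\<bar> \<le> B"
  shows "\<bar>favg F (\<lambda>g. \<phi> (h + g)) - favg F \<phi>\<bar>
       \<le> B * (real (card (((+) h ` F) - F \<union> (F - (+) h ` F))) / real (card F))"
proof -
  let ?F = "(+) h ` F"
  have fin: "finite ?F" using F by simp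
  have inj: "inj_on ((+) h) F" by simp
  have "(\<Sum>g\<in>F. \<phi> (h + g)) = sum \<phi> ?F"
    by (simp add: sum.reindex[OF inj])
  also have "\<dots> = sum \<phi> (?F - F) + sum \<phi> (?F \<inter> F)"
    using fin by (metis sum.Int_Diff add.commute)
  finally have 1: "(\<Sum>g\<in>F. \<phi> (h + g)) = sum \<phi> (?F - F) + sum \<phi> (?F \<inter> F)" .
  have 2: "sum \<phi> F = sum \<phi> (F - ?F) + sum \<phi> (?F \<inter> F)"
    using F by (metis sum.Int_Diff add.commute Int_commute)
  have bd: "\<bar>sum \<phi> S\<bar> \<le> B * real (card S)" for S
    using order_trans[OF sum_abs sum_bounded_above[of S "\<lambda>g. \<bar>\<phi> g\<bar>" B]] B by (simp add: mult.commute)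
  have "\<bar>(\<Sum>g\<in>F. \<phi> (h + g)) - sum \<phi> F\<bar> \<le> B * real (card (?F - F)) + B * real (card (F - ?F))"
    using 1 2 bd[of "?F - F"] bd[of "F - ?F"] by linarith
  also have "\<dots> = B * real (card ((?F - F) \<union> (F - ?F)))"
    using F fin by (subst card_Un_disjoint) (auto simp: algebra_simps)
  finally show ?thesis
    by (simp add: favg_def diff_divide_distrib[symmetric] divide_right_mono del: times_divide_eq_right
        flip: times_divide_eq_right) (simp add: divide_right_mono)
qed

lemma folner_finite: "folner F \<Longrightarrow> finite (F n)" "folner F \<Longrightarrow> F n \<noteq> {}"
  by (auto simp: folner_def)

lemma folner_favg_translate:
  fixes F :: "nat \<Rightarrow> 'g::group_add set"
  assumes F: "folner F" and B: "\<And>g. \<bar>\<phi> g\<bar> \<le> B"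
  shows "(\<lambda>n. favg (F n) (\<lambda>g. \<phi> (h + g)) - favg (F n) \<phi>) \<longlonglongrightarrow> 0"
proof -
  let ?r = "\<lambda>n. real (card (((+) h ` F n) - F n \<union> (F n - (+) h ` F n))) / real (card (F n))"
  have "?r \<longlonglongrightarrow> 0"
    using F by (auto simp: folner_def)
  then have "(\<lambda>n. B * ?r n) \<longlonglongrightarrow> 0"
    by (rule tendsto_mult_right_zero)
  then show ?thesis
    by (rule Lim_null_comparison[rotated])
       (auto intro!: always_eventually favg_translate B folner_finite[OF F] simp del: times_divide_eq_right)
qed

text \<open>Left and right translations commute, so a right translation carries the symmetric
  differences bijectively to those of the translated sets. The shift \<open>t n\<close> may
  therefore vary freely with \<open>n\<close>, which allows lower density bounds to be proved one
  Folner set at a time.\<close>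

lemma folner_translate_right:
  fixes F :: "nat \<Rightarrow> 'g::group_add set"
  assumes F: "folner F"
  shows "folner (\<lambda>n. (\<lambda>g. g + t n) ` F n)"
proof -
  have inj: "inj (\<lambda>g. g + t n)" for n by (simp add: inj_on_def)
  have "(+) g ` (\<lambda>g. g + t n) ` F n - (\<lambda>g. g + t n) ` F n \<union>
        ((\<lambda>g. g + t n) ` F n - (+) g ` (\<lambda>g. g + t n) ` F n)
      = (\<lambda>g. g + t n) ` (((+) g ` F n) - F n \<union> (F n - (+) g ` F n))" for g n
  proof -
    have "(+) g ` (\<lambda>g. g + t n) ` F n = (\<lambda>g. g + t n) ` (+) g ` F n"
      by (simp add: image_image add.assoc)
    then show ?thesis
      by (simp add: image_Un image_set_diff[OF inj])
  qed
  then have "card ((+) g ` (\<lambda>g. g + t n) ` F n - (\<lambda>g. g + t n) ` F n \<union>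
        ((\<lambda>g. g + t n) ` F n - (+) g ` (\<lambda>g. g + t n) ` F n))
      = card (((+) g ` F n) - F n \<union> (F n - (+) g ` F n))" for g n
    using inj by (simp add: card_image inj_on_subset)
  moreover have "card ((\<lambda>g. g + t n) ` F n) = card (F n)" for n
    using inj by (simp add: card_image inj_on_subset)
  ultimately show ?thesis
    using F by (simp add: folner_def)
qed

section \<open>Invariant means and their iterates\<close>

definition is_mean :: "(('g::group_add \<Rightarrow> real) \<Rightarrow> real) \<Rightarrow> bool" where
  "is_mean \<Lambda> \<longleftrightarrow>
     (\<forall>f h. bounded (range f) \<and> bounded (range h) \<longrightarrow> \<Lambda> (\<lambda>g. f g + h g) = \<Lambda> f + \<Lambda> h) \<and>
     (\<forall>f c. bounded (range f) \<longrightarrow> \<Lambda> (\<lambda>g. c * f g) = c * \<Lambda> f) \<and>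
     (\<forall>f. bounded (range f) \<and> (\<forall>g. 0 \<le> f g) \<longrightarrow> 0 \<le> \<Lambda> f) \<and>
     \<Lambda> (\<lambda>_. 1) = 1 \<and>
     (\<forall>f h. bounded (range f) \<longrightarrow> \<Lambda> (\<lambda>g. f (h + g)) = \<Lambda> f)"

text \<open>Cluster points take the place of limits along an ultrafilter: a closed condition that
  holds eventually passes to them.\<close>

lemma cluster_point_closed:
  fixes L :: "'a::topological_space"
  assumes "inf (nhds L) F \<noteq> bot" "closed C" "eventually (\<lambda>x. x \<in> C) F"
  shows "L \<in> C"
proof (rule ccontr)
  assume "L \<notin> C"
  then have "eventually (\<lambda>x. x \<notin> C) (nhds L)"
    using assms(2) by (auto simp: eventually_nhds intro!: exI[of _ "- C"])
  then have "eventually (\<lambda>x. x \<notin> C \<and> x \<in> C) (inf (nhds L) F)"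
    using assms(3) by (auto simp: eventually_inf)
  then show False using assms(1) by (simp add: trivial_limit_def)
qed

text \<open>By Tychonoff the Folner averages, seen as functionals, have a cluster point
  \<open>L\<close>. Linearity, positivity and normalisation are closed conditions valid for every
  average; translation invariance holds only asymptotically, so it is passed on with an arbitrary
  error \<open>e\<close>.\<close>

lemma exists_invariant_mean:
  assumes "amenable TYPE('g::group_add)"
  shows "\<exists>\<Lambda> :: ('g \<Rightarrow> real) \<Rightarrow> real. is_mean \<Lambda>"
proof -
  obtain F :: "nat \<Rightarrow> 'g set" where F: "folner F"
    using assms by (auto simp: amenable_def)
  note fin = folner_finite[OF F]
  \<comment> \<open>The value on unbounded functions is set to 0, since their averages need not stay
    in a compact set; the summand \<open>{0}\<close> in \<open>I\<close> accounts for this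
    case.\<close>
  define A where "A n f = (if bounded (range f) then favg (F n) f else 0)" for n and f :: "'g \<Rightarrow> real"
  define I where "I f = {- (SOME B. \<forall>g. \<bar>f g\<bar> \<le> B) .. (SOME B. \<forall>g. \<bar>f g\<bar> \<le> B)} \<union> {0::real}"
    for f :: "'g \<Rightarrow> real"
  have AI: "A n f \<in> I f" for n f
  proof (cases "bounded (range f)")
    case True
    then have "\<exists>B. \<forall>g. \<bar>f g\<bar> \<le> B" by (auto simp: bounded_iff)
    then have "\<forall>g. \<bar>f g\<bar> \<le> (SOME B. \<forall>g. \<bar>f g\<bar> \<le> B)" by (rule someI_ex)
    then have "\<bar>favg (F n) f\<bar> \<le> (SOME B. \<forall>g. \<bar>f g\<bar> \<le> B)"
      by (intro favg_abs_le fin) auto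
    then show ?thesis using True by (simp add: A_def I_def abs_le_iff)
  qed (simp add: A_def I_def)
  have "compactin (product_topology (\<lambda>_. euclidean) UNIV) (PiE UNIV I)"
    by (simp add: compactin_PiE I_def compact_Un)
  then have "compact (PiE UNIV I)"
    by (simp add: euclidean_product_topology)
  moreover have "eventually (\<lambda>L. L \<in> PiE UNIV I) (filtermap A sequentially)"
    using AI by (auto simp: eventually_filtermap PiE_def extensional_def intro!: always_eventually)
  moreover have "filtermap A sequentially \<noteq> bot" by (simp add: filtermap_bot_iff)
  ultimately obtain L where L: "inf (nhds L) (filtermap A sequentially) \<noteq> bot"
    by (auto simp: compact_filter)
  have cl: "L \<in> C" if "closed C" "\<And>n. A n \<in> C" for C
    using cluster_point_closed[OF L that(1)] that(2) by (simp add: eventually_filtermap)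
  have ev: "continuous_on UNIV (\<lambda>L::('g \<Rightarrow> real) \<Rightarrow> real. L f)" for f
    by (rule continuous_on_product_coordinates)
  have "L (\<lambda>g. f g + h g) = L f + L h" if "bounded (range f)" "bounded (range h)" for f h
  proof -
    have "bounded (range (\<lambda>g. f g + h g))"
      using that by (intro bounded_plus_comp)
    then have "A n \<in> {L. L (\<lambda>g. f g + h g) = L f + L h}" for n
      using that by (simp add: A_def favg_add)
    moreover have "closed {L :: ('g \<Rightarrow> real) \<Rightarrow> real. L (\<lambda>g. f g + h g) = L f + L h}"
      by (intro closed_Collect_eq ev continuous_on_add)
    ultimately show ?thesis using cl by blast
  qed
  moreover have "L (\<lambda>g. c * f g) = c * L f" if "bounded (range f)" for f c
  proof -
    have "bounded (range (\<lambda>g. c * f g))"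
      using that bounded_scaling[of "range f" c] by (simp add: image_image)
    then have "A n \<in> {L. L (\<lambda>g. c * f g) = c * L f}" for n
      using that by (simp add: A_def favg_cmult)
    moreover have "closed {L :: ('g \<Rightarrow> real) \<Rightarrow> real. L (\<lambda>g. c * f g) = c * L f}"
      by (intro closed_Collect_eq ev continuous_on_mult continuous_on_const)
    ultimately show ?thesis using cl by blast
  qed
  moreover have "0 \<le> L f" if "bounded (range f)" "\<forall>g. 0 \<le> f g" for f
  proof -
    have "A n \<in> {L. 0 \<le> L f}" for n
      using that by (auto simp add: A_def favg_def intro!: divide_nonneg_nonneg sum_nonneg)
    moreover have "closed {L :: ('g \<Rightarrow> real) \<Rightarrow> real. 0 \<le> L f}"
      by (intro closed_Collect_le ev continuous_on_const)
    ultimately show ?thesis using cl by blast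
  qed
  moreover have "L (\<lambda>_. 1) = 1"
  proof -
    have "A n \<in> {L. L (\<lambda>_. 1) = 1}" for n
      using fin by (simp add: A_def favg_const)
    moreover have "closed {L :: ('g \<Rightarrow> real) \<Rightarrow> real. L (\<lambda>_. 1) = 1}"
      by (intro closed_Collect_eq ev continuous_on_const)
    ultimately show ?thesis using cl by blast
  qed
  moreover have "L (\<lambda>g. f (h + g)) = L f" if f: "bounded (range f)" for f h
  proof -
    obtain B where B: "\<And>g. \<bar>f g\<bar> \<le> B" using f by (auto simp: bounded_iff)
    have b2: "bounded (range (\<lambda>g. f (h + g)))"
      using B by (auto simp: bounded_iff)
    have "\<bar>L (\<lambda>g. f (h + g)) - L f\<bar> \<le> e" if "e > 0" for e
    proof -
      have "eventually (\<lambda>n. \<bar>favg (F n) (\<lambda>g. f (h + g)) - favg (F n) f\<bar> < e) sequentially"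
        using folner_favg_translate[where h = h and \<phi> = f, OF F B] that by (simp add: tendsto_iff dist_real_def)
      then have "eventually (\<lambda>L. L \<in> {L. \<bar>L (\<lambda>g. f (h + g)) - L f\<bar> \<le> e}) (filtermap A sequentially)"
        using f b2 by (simp add: eventually_filtermap A_def) (erule eventually_mono, simp)
      moreover have "closed {L :: ('g \<Rightarrow> real) \<Rightarrow> real. \<bar>L (\<lambda>g. f (h + g)) - L f\<bar> \<le> e}"
        by (intro closed_Collect_le ev continuous_on_const continuous_on_rabs continuous_on_diff)
      ultimately show ?thesis using cluster_point_closed[OF L] by blast
    qed
    then show ?thesis
      by (metis abs_le_zero_iff eq_iff_diff_eq_0 field_le_epsilon add_0)
  qed
  ultimately show ?thesis
    unfolding is_mean_def by blast
qed

lemma mean_add: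
  "is_mean \<Lambda> \<Longrightarrow> bounded (range f) \<Longrightarrow> bounded (range h) \<Longrightarrow> \<Lambda> (\<lambda>g. f g + h g) = \<Lambda> f + \<Lambda> h"
  unfolding is_mean_def by blast

lemma mean_cmult: "is_mean \<Lambda> \<Longrightarrow> bounded (range f) \<Longrightarrow> \<Lambda> (\<lambda>g. c * f g) = c * \<Lambda> f"
  unfolding is_mean_def by blast

lemma mean_nonneg: "is_mean \<Lambda> \<Longrightarrow> bounded (range f) \<Longrightarrow> (\<And>g. 0 \<le> f g) \<Longrightarrow> 0 \<le> \<Lambda> f"
  unfolding is_mean_def by blast

lemma mean_translate: "is_mean \<Lambda> \<Longrightarrow> bounded (range f) \<Longrightarrow> \<Lambda> (\<lambda>g. f (h + g)) = \<Lambda> f"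
  unfolding is_mean_def by blast

lemma mean_const: "is_mean \<Lambda> \<Longrightarrow> \<Lambda> (\<lambda>_. c) = c"
proof -
  assume L: "is_mean \<Lambda>"
  then have "\<Lambda> (\<lambda>_. 1) = 1" unfolding is_mean_def by blast
  then show ?thesis using mean_cmult[OF L, of "\<lambda>_. 1" c] by simp
qed

lemma bounded_range_realI:
  fixes f :: "'a \<Rightarrow> real"
  shows "(\<And>g. \<bar>f g\<bar> \<le> B) \<Longrightarrow> bounded (range f)"
  by (auto simp: bounded_iff)

lemma mean_mono:
  assumes L: "is_mean \<Lambda>" and f: "bounded (range f)" and h: "bounded (range h)"
    and le: "\<And>g. f g \<le> h g"
  shows "\<Lambda> f \<le> \<Lambda> h"
proof -
  have n: "bounded (range (\<lambda>g. (- 1) * f g))"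
    using bounded_scaling[OF f, of "- 1"] by (simp add: image_image)
  have b: "bounded (range (\<lambda>g. h g + (- 1) * f g))"
    by (rule bounded_plus_comp[OF h n])
  have "0 \<le> \<Lambda> (\<lambda>g. h g + (- 1) * f g)"
    by (rule mean_nonneg[OF L b]) (simp add: le)
  also have "\<dots> = \<Lambda> h + \<Lambda> (\<lambda>g. (- 1) * f g)"
    by (rule mean_add[OF L h n])
  also have "\<Lambda> (\<lambda>g. (- 1) * f g) = (- 1) * \<Lambda> f"
    by (rule mean_cmult[OF L f])
  finally show ?thesis by simp
qed

lemma mean_abs_le:
  assumes L: "is_mean \<Lambda>" and B: "\<And>g. \<bar>f g\<bar> \<le> B"
  shows "\<bar>\<Lambda> f\<bar> \<le> B"
proof -
  have b: "bounded (range f)" using B by (rule bounded_range_realI)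
  have c: "bounded (range (\<lambda>_::'a. c))" for c :: real by simp
  have "- B \<le> f g" "f g \<le> B" for g using B[of g] by (auto simp: abs_le_iff)
  then have "\<Lambda> (\<lambda>_. - B) \<le> \<Lambda> f" "\<Lambda> f \<le> \<Lambda> (\<lambda>_. B)"
    using mean_mono[OF L c b] mean_mono[OF L b c] by blast+
  then show ?thesis using mean_const[OF L] by (simp add: abs_le_iff)
qed

lemma mean_sum:
  assumes "is_mean \<Lambda>" "finite S" "\<And>s. s \<in> S \<Longrightarrow> bounded (range (f s))"
  shows "bounded (range (\<lambda>g. \<Sum>s\<in>S. f s g)) \<and> \<Lambda> (\<lambda>g. \<Sum>s\<in>S. f s g) = (\<Sum>s\<in>S. \<Lambda> (f s))"
  using assms(2,3)
proof (induction S)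
  case empty
  then show ?case using mean_const[OF assms(1)] by simp
next
  case (insert s S)
  then have b: "bounded (range (f s))" "bounded (range (\<lambda>g. \<Sum>s\<in>S. f s g))"
    and IH: "\<Lambda> (\<lambda>g. \<Sum>s\<in>S. f s g) = (\<Sum>s\<in>S. \<Lambda> (f s))" by auto
  have eq: "(\<lambda>g. \<Sum>s\<in>insert s S. f s g) = (\<lambda>g. f s g + (\<Sum>s\<in>S. f s g))"
    using insert.hyps by simp
  show ?case
    unfolding eq using mean_add[OF assms(1) b] bounded_plus_comp[OF b] IH insert.hyps by simp
qed

text \<open>A finitely additive analogue of the product of \<open>m\<close> copies of
  \<open>\<Lambda>\<close>: the variable \<open>m - 1\<close> is averaged last, and the variables
  from \<open>m\<close> on are 0. The order of averaging is fixed because means need not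
  commute.\<close>

primrec iter_mean :: "(('g::group_add \<Rightarrow> real) \<Rightarrow> real) \<Rightarrow> nat \<Rightarrow> ((nat \<Rightarrow> 'g) \<Rightarrow> real) \<Rightarrow> real" where
  "iter_mean \<Lambda> 0 f = f (\<lambda>_. 0)"
| "iter_mean \<Lambda> (Suc m) f = \<Lambda> (\<lambda>h. iter_mean \<Lambda> m (\<lambda>k. f (k(m := h))))"

lemma iter_mean_abs_le:
  assumes "is_mean \<Lambda>"
  shows "(\<And>k. \<bar>f k\<bar> \<le> B) \<Longrightarrow> \<bar>iter_mean \<Lambda> m f\<bar> \<le> B"
  by (induction m arbitrary: f) (auto intro!: mean_abs_le[OF assms])

lemma iter_mean_add:
  assumes L: "is_mean \<Lambda>"
  shows "(\<And>k. \<bar>f k\<bar> \<le> B) \<Longrightarrow> (\<And>k. \<bar>h k\<bar> \<le> B) \<Longrightarrow>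
    iter_mean \<Lambda> m (\<lambda>k. f k + h k) = iter_mean \<Lambda> m f + iter_mean \<Lambda> m h"
proof (induction m arbitrary: f h)
  case (Suc m)
  have b: "bounded (range (\<lambda>x. iter_mean \<Lambda> m (\<lambda>k. f (k(m := x)))))"
    "bounded (range (\<lambda>x. iter_mean \<Lambda> m (\<lambda>k. h (k(m := x)))))"
    by (rule bounded_range_realI[of _ B], rule iter_mean_abs_le[OF L], rule Suc.prems)+
  show ?case
    using Suc mean_add[OF L b] by simp
qed simp

lemma iter_mean_cmult:
  assumes L: "is_mean \<Lambda>"
  shows "(\<And>k. \<bar>f k\<bar> \<le> B) \<Longrightarrow> iter_mean \<Lambda> m (\<lambda>k. c * f k) = c * iter_mean \<Lambda> m f"
proof (induction m arbitrary: f)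
  case (Suc m)
  have b: "bounded (range (\<lambda>x. iter_mean \<Lambda> m (\<lambda>k. f (k(m := x)))))"
    by (rule bounded_range_realI[of _ B], rule iter_mean_abs_le[OF L], rule Suc.prems)
  show ?case
    using Suc mean_cmult[OF L b] by simp
qed simp

lemma iter_mean_nonneg:
  assumes L: "is_mean \<Lambda>"
  shows "(\<And>k. \<bar>f k\<bar> \<le> B) \<Longrightarrow> (\<And>k. 0 \<le> f k) \<Longrightarrow> 0 \<le> iter_mean \<Lambda> m f"
proof (induction m arbitrary: f)
  case (Suc m)
  have b: "bounded (range (\<lambda>x. iter_mean \<Lambda> m (\<lambda>k. f (k(m := x)))))"
    by (rule bounded_range_realI[of _ B], rule iter_mean_abs_le[OF L], rule Suc.prems)
  show ?case
    using Suc mean_nonneg[OF L b] by simp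
qed simp

text \<open>The shift of the last averaged variable is absorbed by the invariance of
  \<open>\<Lambda>\<close>, the other shifts by the induction hypothesis for \<open>f\<close> with
  the variable \<open>m\<close> frozen at \<open>g + h\<close>.\<close>

lemma iter_mean_translate:
  assumes L: "is_mean \<Lambda>"
  shows "(\<And>k. \<bar>f k\<bar> \<le> B) \<Longrightarrow>
    iter_mean \<Lambda> m (\<lambda>k. f (\<lambda>i. if i < m then g + k i else k i)) = iter_mean \<Lambda> m f"
proof (induction m arbitrary: f)
  case (Suc m)
  let ?\<Phi> = "\<lambda>x. iter_mean \<Lambda> m (\<lambda>k. f (k(m := x)))"
  have b: "bounded (range ?\<Phi>)"
    by (rule bounded_range_realI[of _ B], rule iter_mean_abs_le[OF L], rule Suc.prems)
  have eq: "(\<lambda>i. if i < Suc m then g + (k(m := h)) i else (k(m := h)) i)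
      = (\<lambda>i. if i < m then g + k i else k i)(m := g + h)" for k h
    by (auto simp: fun_eq_iff less_Suc_eq)
  have "iter_mean \<Lambda> (Suc m) (\<lambda>k. f (\<lambda>i. if i < Suc m then g + k i else k i))
      = \<Lambda> (\<lambda>h. iter_mean \<Lambda> m (\<lambda>k. f ((\<lambda>i. if i < m then g + k i else k i)(m := g + h))))"
    by (simp only: iter_mean.simps eq)
  also have "\<dots> = \<Lambda> (\<lambda>h. ?\<Phi> (g + h))"
    using Suc.IH[of "\<lambda>k. f (k(m := g + h))" for h] Suc.prems by simp
  also have "\<dots> = \<Lambda> ?\<Phi>" by (rule mean_translate[OF L b])
  finally show ?case by simp
qed simp

text \<open>When one variable is averaged, the factors in the other variables are constants. This
  gives open boxes positive content.\<close>

lemma iter_mean_prod: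
  assumes L: "is_mean \<Lambda>" and a: "\<And>i g. \<bar>a i g\<bar> \<le> 1"
  shows "iter_mean \<Lambda> m (\<lambda>k. \<Prod>i<m. a i (k i)) = (\<Prod>i<m. \<Lambda> (a i))"
proof (induction m)
  case (Suc m)
  have p: "\<bar>\<Prod>i<m. a i (k i)\<bar> \<le> 1" for k
    unfolding abs_prod using a by (intro prod_le_1) auto
  have "(\<lambda>k. \<Prod>i<Suc m. a i ((k(m := h)) i)) = (\<lambda>k. a m h * (\<Prod>i<m. a i (k i)))" for h
    by (simp add: fun_eq_iff mult.commute)
  then have "iter_mean \<Lambda> (Suc m) (\<lambda>k. \<Prod>i<Suc m. a i (k i))
      = \<Lambda> (\<lambda>h. iter_mean \<Lambda> m (\<lambda>k. a m h * (\<Prod>i<m. a i (k i))))"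
    by simp
  also have "\<dots> = \<Lambda> (\<lambda>h. (\<Prod>i<m. \<Lambda> (a i)) * a m h)"
    by (subst iter_mean_cmult[OF L p]) (simp add: Suc mult.commute)
  also have "\<dots> = (\<Prod>i<m. \<Lambda> (a i)) * \<Lambda> (a m)"
    by (intro mean_cmult[OF L] bounded_range_realI[OF a])
  finally show ?case by (simp add: mult.commute)
qed simp

section \<open>Minimal systems and an invariant content on their powers\<close>

locale minimal_tds =
  fixes act :: "'g::group_add \<Rightarrow> 'x::metric_space \<Rightarrow> 'x"
  assumes tds: "tds act" and minimal: "minimal_system act"
begin

lemma compact_X: "compact (UNIV :: 'x set)"
  using tds by (simp add: tds_def)

lemma act_0 [simp]: "act 0 x = x"
  using tds by (simp add: tds_def is_action_def)

lemma act_add: "act (g + h) x = act g (act h x)"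
  using tds by (simp add: tds_def is_action_def)

lemma act_inverse [simp]: "act (- g) (act g x) = x" "act g (act (- g) x) = x"
  by (simp_all flip: act_add)

lemma continuous_act: "continuous_on UNIV (act g)"
  using tds by (simp add: tds_def is_action_def)

lemma open_vimage_act: "open U \<Longrightarrow> open (act g -` U)"
  using continuous_act by (rule open_vimage[rotated])

lemma image_act_eq: "act g ` U = act (- g) -` U"
  by (auto simp: image_iff) (metis act_inverse(2))

lemma open_image_act: "open U \<Longrightarrow> open (act g ` U)"
  by (simp add: image_act_eq open_vimage_act)

lemma orbit_meets_open:
  assumes "open U" "U \<noteq> {}"
  shows "\<exists>g. act g x \<in> U"
proof -
  let ?O = "range (\<lambda>g. act g x)"
  have "act h ` closure ?O \<subseteq> closure ?O" for h
  proof (rule image_closure_subset)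
    show "continuous_on (closure ?O) (act h)"
      using continuous_act continuous_on_subset by blast
    show "act h ` ?O \<subseteq> closure ?O"
      by (rule order_trans[OF _ closure_subset]) (auto simp flip: act_add)
  qed simp
  then have "closure ?O = UNIV"
    using minimal unfolding minimal_system_def minimal_set_def invariant_set_def by simp
  then have "U \<inter> ?O \<noteq> {}"
    using assms open_Int_closure_eq_empty[of U ?O] by auto
  then show ?thesis by auto
qed

text \<open>By minimality the preimages of \<open>U\<close> cover the space, and compactness leaves
  finitely many of them: return times are syndetic, uniformly in the starting point.\<close>

lemma finite_return:
  assumes "open U" "U \<noteq> {}"
  shows "\<exists>S. finite S \<and> (\<forall>x. \<exists>s\<in>S. act s x \<in> U)"
proof -
  have "UNIV \<subseteq> (\<Union>s\<in>UNIV. act s -` U)"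
    using orbit_meets_open[OF assms] by auto
  from compactE_image[OF compact_X _ this] open_vimage_act[OF assms(1)]
  obtain S where "finite S" "UNIV \<subseteq> (\<Union>s\<in>S. act s -` U)" by metis
  then show ?thesis by (intro exI[of _ S]) auto
qed

text \<open>For every \<open>g\<close> some \<open>s + g\<close> with \<open>s\<close> in the finite
  set \<open>S\<close> is a visit to \<open>U\<close>; by invariance \<open>card S\<close> equal
  means add up to at least 1.\<close>

lemma mean_open_pos:
  assumes L: "is_mean \<Lambda>" and U: "open U" "U \<noteq> {}"
  shows "0 < \<Lambda> (\<lambda>g. indicator U (act g x))"
proof -
  obtain S where S: "finite S" "\<And>x. \<exists>s\<in>S. act s x \<in> U"
    using finite_return[OF U] by blast
  have b: "bounded (range (\<lambda>g. indicator U (act (s + g) x) :: real))" for s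
    by (rule bounded_range_realI[of _ 1]) (simp add: indicator_def)
  have "1 = \<Lambda> (\<lambda>_. 1)" using mean_const[OF L] by simp
  also have "\<dots> \<le> \<Lambda> (\<lambda>g. \<Sum>s\<in>S. indicator U (act (s + g) x))"
  proof (rule mean_mono[OF L])
    show "bounded (range (\<lambda>g. \<Sum>s\<in>S. indicator U (act (s + g) x) :: real))"
      using mean_sum[OF L S(1), of "\<lambda>s g. indicator U (act (s + g) x)"] b by blast
    fix g
    obtain s where s: "s \<in> S" "act (s + g) x \<in> U" using S(2) by (auto simp: act_add)
    then have "1 \<le> (indicator U (act (s + g) x) :: real)" by simp
    also have "\<dots> \<le> (\<Sum>s\<in>S. indicator U (act (s + g) x))"
      using s S(1) by (intro member_le_sum) auto
    finally show "1 \<le> (\<Sum>s\<in>S. indicator U (act (s + g) x) :: real)" .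
  qed simp
  also have "\<dots> = (\<Sum>s\<in>S. \<Lambda> (\<lambda>g. indicator U (act (s + g) x)))"
    using mean_sum[OF L S(1), of "\<lambda>s g. indicator U (act (s + g) x)"] b by blast
  also have "\<dots> = (\<Sum>s\<in>S. \<Lambda> (\<lambda>g. indicator U (act g x)))"
    using mean_translate[OF L b[of 0]] by simp
  finally have "1 \<le> real (card S) * \<Lambda> (\<lambda>g. indicator U (act g x))" by simp
  moreover have "0 \<le> \<Lambda> (\<lambda>g. indicator U (act g x))"
    using b[of 0] by (intro mean_nonneg[OF L]) auto
  ultimately show ?thesis by (cases "\<Lambda> (\<lambda>g. indicator U (act g x)) = 0") auto
qed

text \<open>\<open>\<mu>\<close> moves a point \<open>x0\<close> independently in the first
  \<open>m\<close> coordinates and averages with the iterated mean. A diagonal shift translates all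
  variables at once, and boxes factor into visits to open sets. Invariance concerns sets that depend
  on the first \<open>m\<close> coordinates because the sampled sequences are \<open>x0\<close> in
  all others.\<close>

lemma invariant_product_content:
  assumes "amenable TYPE('g)"
  shows "\<exists>\<mu> :: (nat \<Rightarrow> 'x) set \<Rightarrow> real.
    (\<forall>A. 0 \<le> \<mu> A) \<and> (\<forall>A B. A \<inter> B = {} \<longrightarrow> \<mu> (A \<union> B) = \<mu> A + \<mu> B) \<and>
    (\<forall>g S. (\<forall>z z'. (\<forall>i<m. z i = z' i) \<longrightarrow> z \<in> S \<longrightarrow> z' \<in> S) \<longrightarrow>
       \<mu> {z. (\<lambda>i. act g (z i)) \<in> S} = \<mu> S) \<and>
    (\<forall>U. (\<forall>i<m. open (U i) \<and> U i \<noteq> {}) \<longrightarrow> 0 < \<mu> {z. \<forall>i<m. z i \<in> U i})"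
proof -
  obtain \<Lambda> :: "('g \<Rightarrow> real) \<Rightarrow> real" where L: "is_mean \<Lambda>"
    using exists_invariant_mean[OF assms] by blast
  fix x0 :: 'x
  define \<mu> where "\<mu> S = iter_mean \<Lambda> m (\<lambda>k. indicator S (\<lambda>i. act (k i) x0))" for S
  have b: "\<bar>indicator S z :: real\<bar> \<le> 1" for S and z :: "nat \<Rightarrow> 'x"
    by (simp add: indicator_def)
  show ?thesis
  proof (intro exI[of _ \<mu>] conjI allI impI)
    show "0 \<le> \<mu> A" for A
      unfolding \<mu>_def by (rule iter_mean_nonneg[OF L b]) simp
    show "\<mu> (A \<union> B) = \<mu> A + \<mu> B" if "A \<inter> B = {}" for A B
    proof -
      have "\<mu> (A \<union> B) = iter_mean \<Lambda> m (\<lambda>k. indicator A (\<lambda>i. act (k i) x0) + indicator B (\<lambda>i. act (k i) x0))"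
        unfolding \<mu>_def using that
        by (intro arg_cong[where f = "iter_mean \<Lambda> m"]) (auto simp: fun_eq_iff indicator_def)
      then show ?thesis
        unfolding \<mu>_def by (simp add: iter_mean_add[OF L b b])
    qed
    show "\<mu> {z. (\<lambda>i. act g (z i)) \<in> S} = \<mu> S"
      if "\<forall>z z'. (\<forall>i<m. z i = z' i) \<longrightarrow> z \<in> S \<longrightarrow> z' \<in> S" for g S
    proof -
      from that have S: "\<And>z z'. (\<And>i. i < m \<Longrightarrow> z i = z' i) \<Longrightarrow> z \<in> S \<Longrightarrow> z' \<in> S" by blast
      have "(\<lambda>i. act g (act (k i) x0)) \<in> S \<longleftrightarrow> (\<lambda>i. act (if i < m then g + k i else k i) x0) \<in> S" for k
        by (rule iffI; erule S[rotated]; simp add: act_add)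
      then have "\<mu> {z. (\<lambda>i. act g (z i)) \<in> S}
          = iter_mean \<Lambda> m (\<lambda>k. indicator S (\<lambda>i. act (if i < m then g + k i else k i) x0))"
        unfolding \<mu>_def by (simp add: indicator_def)
      also have "\<dots> = \<mu> S"
        unfolding \<mu>_def
        using iter_mean_translate[OF L, of "\<lambda>k. indicator S (\<lambda>i. act (k i) x0)" 1 m g] b by simp
      finally show ?thesis .
    qed
    show "0 < \<mu> {z. \<forall>i<m. z i \<in> U i}" if U: "\<forall>i<m. open (U i) \<and> U i \<noteq> {}" for U
    proof -
      have "indicator {z. \<forall>i<m. z i \<in> U i} z = (\<Prod>i<m. indicator (U i) (z i) :: real)" for z
        by (simp add: indicator_def prod.If_cases) auto
      then have "\<mu> {z. \<forall>i<m. z i \<in> U i} = iter_mean \<Lambda> m (\<lambda>k. \<Prod>i<m. indicator (U i) (act (k i) x0))"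
        unfolding \<mu>_def by simp
      also have "\<dots> = (\<Prod>i<m. \<Lambda> (\<lambda>g. indicator (U i) (act g x0)))"
        by (rule iter_mean_prod[OF L, of "\<lambda>i g. indicator (U i) (act g x0)"]) (simp add: indicator_def)
      also have "\<dots> > 0"
        using U by (intro prod_pos ballI mean_open_pos[OF L]) auto
      finally show ?thesis .
    qed
  qed
qed

end

section \<open>Recurrence within fibres\<close>

lemma compact_dense_sequence:
  assumes "compact (UNIV :: 'x::metric_space set)"
  shows "\<exists>s :: nat \<Rightarrow> 'x. \<forall>x. \<forall>e>0. \<exists>n. dist x (s n) < e"
proof -
  have "\<forall>n::nat. \<exists>k. finite k \<and> UNIV \<subseteq> (\<Union>x\<in>k. ball (x::'x) (inverse (real (Suc n))))"
    using assms unfolding compact_eq_totally_bounded by auto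
  then obtain k where k: "\<And>n. finite (k n)" "\<And>n. UNIV \<subseteq> (\<Union>x\<in>k n. ball (x::'x) (inverse (real (Suc n))))"
    by metis
  define C where "C = (\<Union>n. k n)"
  have C: "countable C" using k(1) by (auto simp: C_def countable_finite)
  have "C \<noteq> {}" using k(2)[of 0] by (fastforce simp: C_def)
  then have r: "range (from_nat_into C) = C" using C by (rule range_from_nat_into)
  show ?thesis
  proof (intro exI[of _ "from_nat_into C"] allI impI)
    fix x and e :: real assume "e > 0"
    then obtain n where n: "inverse (real (Suc n)) < e" using reals_Archimedean by blast
    obtain y where "y \<in> k n" "x \<in> ball y (inverse (real (Suc n)))" using k(2)[of n] by blast
    then have "y \<in> range (from_nat_into C)" "dist x y < e"
      unfolding r using n by (auto simp: C_def dist_commute)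
    then show "\<exists>m. dist x (from_nat_into C m) < e" by auto
  qed
qed

text \<open>A single summand of the series defining \<open>dist\<close> controls the coordinate
  \<open>n\<close>, up to its weight \<open>(1/2) ^ to_nat n\<close>.\<close>

lemma dist_fun_coordinate:
  fixes n :: nat
  assumes "e > 0"
  shows "\<exists>d>0. \<forall>q q' :: nat \<Rightarrow> real. dist q q' < d \<longrightarrow> \<bar>q n - q' n\<bar> < e"
proof -
  define d where "d = (1/2::real) ^ to_nat n * min e 1"
  have "\<bar>q n - q' n\<bar> < e" if "dist q q' < d" for q q' :: "nat \<Rightarrow> real"
  proof -
    let ?f = "\<lambda>m. (1/2) ^ m * min (dist (q (from_nat m)) (q' (from_nat m))) 1 :: real"
    have "summable ?f"
      by (rule summable_comparison_test'[of "\<lambda>m. (1/2)^m" 0]) (auto simp: summable_geometric)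
    then have "sum ?f {to_nat n} \<le> suminf ?f"
      by (rule sum_le_suminf) auto
    then have "(1/2) ^ to_nat n * min (dist (q n) (q' n)) 1 \<le> dist q q'"
      unfolding dist_fun_def by simp
    then have "(1/2) ^ to_nat n * min (dist (q n) (q' n)) 1 < (1/2) ^ to_nat n * min e 1"
      using that unfolding d_def by (rule le_less_trans)
    then have "min (dist (q n) (q' n)) 1 < min e 1"
      by (subst (asm) mult_less_cancel_left_pos) auto
    then show ?thesis by (simp add: dist_real_def min_def split: if_splits)
  qed
  moreover have "d > 0" using assms by (simp add: d_def)
  ultimately show ?thesis by blast
qed

lemma dist_fun_le_sup:
  fixes q q' :: "nat \<Rightarrow> real"
  assumes "\<And>n. \<bar>q n - q' n\<bar> \<le> B"
  shows "dist q q' \<le> 2 * B + (1/2) ^ N"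
proof -
  have "Max {dist (q (from_nat n)) (q' (from_nat n)) |n. n \<le> N} \<le> B"
    using assms by (intro Max.boundedI) (auto simp: dist_real_def)
  then show ?thesis
    using dist_fun_le_dist_first_terms[of q q' N] by linarith
qed

section \<open>The maximal equicontinuous factor and McMahon's argument\<close>

locale mef_tds = minimal_tds act
  for act :: "'g::group_add \<Rightarrow> 'x::metric_space \<Rightarrow> 'x" +
  fixes act' :: "'g \<Rightarrow> 'y::metric_space \<Rightarrow> 'y" and \<pi> :: "'x \<Rightarrow> 'y"
  assumes amenable: "amenable TYPE('g)" and max_eq: "max_eq_factor act act' \<pi>"
begin

lemma continuous_pi: "continuous_on UNIV \<pi>"
  and surj_pi: "surj \<pi>"
  and pi_act: "\<pi> (act g x) = act' g (\<pi> x)"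
  using max_eq by (auto simp: max_eq_factor_def factor_map_def)

lemma open_vimage_pi: "open U \<Longrightarrow> open (\<pi> -` U)"
  using continuous_pi by (rule open_vimage[rotated])

text \<open>The quotient by the relation \<open>D = 0\<close> is a factor on which the group acts
  isometrically, so by maximality it factors through \<open>\<pi>\<close>. To realise it inside
  \<open>nat \<Rightarrow> real\<close>, a point is sent to its \<open>D\<close>-distances from a
  dense sequence.\<close>

lemma pseudometric_factors_through_pi:
  fixes D :: "'x \<Rightarrow> 'x \<Rightarrow> real"
  assumes refl: "\<And>x. D x x = 0" and sym: "\<And>x y. D x y = D y x"
    and tri: "\<And>x y z. D x z \<le> D x y + D y z"
    and cont: "\<And>x e. e > 0 \<Longrightarrow> \<exists>d>0. \<forall>x'. dist x x' < d \<longrightarrow> D x x' < e"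
    and inv: "\<And>g x y. D (act g x) (act g y) = D x y"
    and fibre: "\<pi> x = \<pi> x'"
  shows "D x x' = 0"
proof -
  have nonneg: "0 \<le> D x y" for x y
    using tri[of x x y] refl[of x] sym[of x y] by linarith
  have lip: "\<bar>D x a - D y a\<bar> \<le> D x y" for x y a
    using tri[of x a y] tri[of y a x] sym[of x y] by linarith
  have contD: "continuous_on UNIV (\<lambda>x. D x a)" for a
  proof (unfold continuous_on_iff, intro ballI allI impI)
    fix x and e :: real assume "0 < e"
    then obtain d where d: "d > 0" "\<And>x'. dist x x' < d \<Longrightarrow> D x x' < e" using cont by blast
    have "dist (D x' a) (D x a) < e" if "dist x' x < d" for x'
      using lip[of x' a x] d(2)[of x'] that sym[of x x'] by (simp add: dist_real_def dist_commute)
    then show "\<exists>d>0. \<forall>x'\<in>UNIV. dist x' x < d \<longrightarrow> dist (D x' a) (D x a) < e" using d(1) by blast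
  qed
  obtain s :: "nat \<Rightarrow> 'x" where s: "\<forall>x. \<forall>e>0. \<exists>n. dist x (s n) < e"
    using compact_dense_sequence[OF compact_X] by (elim exE)
  have sD: "\<exists>n. D x (s n) < e" if e: "e > 0" for x e
  proof -
    obtain d where d: "d > 0" "\<And>x'. dist x x' < d \<Longrightarrow> D x x' < e" using cont[OF e] by blast
    obtain n where "dist x (s n) < d" using s d(1) by blast
    then show ?thesis using d(2) by blast
  qed
  define p where "p x n = D x (s n)" for x n
  \<comment> \<open>The chosen representative does not matter: points with equal image under
    \<open>p\<close> have \<open>D\<close>-distance 0, and so do their translates.\<close>
  define b where "b g q = p (act g (SOME x. p x = q))" for g q
  \<comment> \<open>Finitely many points of the sequence are \<open>e/3\<close>-dense for
    \<open>D\<close>, so finitely many coordinates of \<open>p\<close> determine \<open>D\<close> up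
    to \<open>e\<close>.\<close>
  have pD: "\<exists>d>0. \<forall>x x'. dist (p x) (p x') < d \<longrightarrow> D x x' < e" if "e > 0" for e
  proof -
    have "open {x. D x (s n) < e/3}" for n
      by (intro open_Collect_less contD continuous_on_const)
    moreover have "UNIV \<subseteq> (\<Union>n\<in>UNIV. {x. D x (s n) < e/3})"
      using sD[of "e/3"] that by auto
    ultimately obtain N where N: "finite N" "UNIV \<subseteq> (\<Union>n\<in>N. {x. D x (s n) < e/3})"
      using compactE_image[OF compact_X, of UNIV "\<lambda>n. {x. D x (s n) < e/3}"] by metis
    have "\<forall>n. \<exists>d>0. \<forall>q q' :: nat \<Rightarrow> real. dist q q' < d \<longrightarrow> \<bar>q n - q' n\<bar> < e/3"
      using that by (intro allI dist_fun_coordinate) simp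
    then obtain d where d: "\<And>n. d n > 0"
      "\<And>n q q'. dist q (q' :: nat \<Rightarrow> real) < d n \<Longrightarrow> \<bar>q n - q' n\<bar> < e/3" by metis
    define d0 where "d0 = Min (insert 1 (d ` N))"
    have d0: "d0 > 0" "\<And>n. n \<in> N \<Longrightarrow> d0 \<le> d n"
      using N(1) d(1) by (auto simp: d0_def)
    have "D x x' < e" if "dist (p x) (p x') < d0" for x x'
    proof -
      obtain n where n: "n \<in> N" "D x (s n) < e/3" using N(2) by blast
      then have "\<bar>p x n - p x' n\<bar> < e/3" using d(2) d0(2) that by fastforce
      then show ?thesis
        using n(2) tri[of x x' "s n"] sym[of "s n" x'] unfolding p_def by linarith
    qed
    then show ?thesis using d0(1) by blast
  qed
  have Dp: "\<exists>d>0. \<forall>x x'. D x x' < d \<longrightarrow> dist (p x) (p x') < e" if e: "e > 0" for e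
  proof -
    obtain N where N: "(1/2::real) ^ N < e/2" using real_arch_pow_inv[of "e/2" "1/2"] e by auto
    have "dist (p x) (p x') < e" if "D x x' < e/4" for x x'
      using dist_fun_le_sup[of "p x" "p x'" "D x x'" N] lip N that by (simp add: p_def)
    then show ?thesis using e by (intro exI[of _ "e/4"]) auto
  qed
  have p0: "D x x' = 0" if "p x = p x'" for x x'
  proof (rule antisym[OF field_le_epsilon nonneg])
    fix e :: real assume "e > 0"
    then obtain d where "d > 0" "\<And>x x'. dist (p x) (p x') < d \<Longrightarrow> D x x' < e" using pD[of e] by blast
    then show "D x x' \<le> 0 + e" using \<open>p x = p x'\<close> by (metis add_0 dist_self less_imp_le)
  qed
  have bp: "b g (p x) = p (act g x)" for g x
  proof -
    have "p (SOME x'. p x' = p x) = p x" by (rule someI[of "\<lambda>x'. p x' = p x"]) simp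
    then have "D (act g (SOME x'. p x' = p x)) (act g x) = 0" using p0 inv by simp
    then have "p (act g (SOME x'. p x' = p x)) = p (act g x)"
      using lip[of "act g (SOME x'. p x' = p x)" _ "act g x"] by (auto simp: p_def fun_eq_iff)
    then show ?thesis by (simp add: b_def)
  qed
  \<comment> \<open>Passing from \<open>p\<close> to \<open>D\<close> and back gives a bound uniform
    in \<open>g\<close>, since \<open>D\<close> is invariant.\<close>
  have eq: "\<exists>d>0. \<forall>x x'. dist (p x) (p x') < d \<longrightarrow> (\<forall>g. dist (p (act g x)) (p (act g x')) < e)"
    if e: "e > 0" for e
  proof -
    obtain d where d: "d > 0" "\<And>x x'. D x x' < d \<Longrightarrow> dist (p x) (p x') < e" using Dp[OF e] by blast
    obtain d' where d': "d' > 0" "\<And>x x'. dist (p x) (p x') < d' \<Longrightarrow> D x x' < d"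
      using pD[OF d(1)] by blast
    have "dist (p (act g x)) (p (act g x')) < e" if "dist (p x) (p x') < d'" for g x x'
      using d'(2)[OF that] by (intro d(2)) (simp add: inv)
    then show ?thesis using d'(1) by blast
  qed
  have "continuous_on UNIV p"
    unfolding p_def by (intro continuous_on_coordinatewise_then_product contD)
  moreover have "equicontinuous_on (range p) b"
    unfolding equicontinuous_on_def
  proof (intro allI impI)
    fix e :: real assume "0 < e"
    then obtain d where "d > 0" "\<And>x x' g. dist (p x) (p x') < d \<Longrightarrow> dist (p (act g x)) (p (act g x')) < e"
      using eq by blast
    then show "\<exists>d>0. \<forall>y\<in>range p. \<forall>y'\<in>range p. dist y y' < d \<longrightarrow> (\<forall>g. dist (b g y) (b g y') < e)"
      by (intro exI[of _ d]) (auto simp: bp)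
  qed
  moreover have "continuous_on (range p) (b g)" for g
  proof (unfold continuous_on_iff, intro ballI allI impI)
    fix q and e :: real assume "q \<in> range p" "0 < e"
    then obtain x d where "q = p x" "d > 0" "\<And>x x'. dist (p x) (p x') < d \<Longrightarrow> dist (p (act g x)) (p (act g x')) < e"
      using eq[of e] by blast
    then show "\<exists>d>0. \<forall>q'\<in>range p. dist q' q < d \<longrightarrow> dist (b g q') (b g q) < e"
      by (intro exI[of _ d]) (auto simp: bp)
  qed
  moreover have "\<forall>g x. p (act g x) = b g (p x)" by (simp add: bp)
  ultimately obtain f where "\<forall>x. p x = f (\<pi> x)"
    using max_eq unfolding max_eq_factor_def by blast
  then have "p x = p x'" using fibre by simp
  then show ?thesis by (rule p0)
qed

text \<open>McMahon's argument: for the closed invariant set \<open>N\<close> generated by \<open>V \<times> W\<close>, the content of the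
  slice \<open>N\<^sub>y\<close> does not depend on \<open>y\<close>, so the content of \<open>N\<^sub>y \<union> N\<^sub>y'\<close> minus this constant is a continuous
  invariant pseudometric and must vanish on fibres.\<close>
lemma joint_return:
  fixes m :: nat
  assumes fibre: "\<pi> x\<^sub>0 = \<pi> x" and V: "open V" "x\<^sub>0 \<in> V" and U: "open U" "x \<in> U"
    and W: "\<And>i. i < m \<Longrightarrow> open (W i) \<and> W i \<noteq> {}"
  shows "\<exists>g. act g ` V \<inter> U \<noteq> {} \<and> (\<forall>i<m. act g ` W i \<inter> W i \<noteq> {})"
proof -
  obtain \<mu> :: "(nat \<Rightarrow> 'x) set \<Rightarrow> real"
    where nonneg: "\<forall>A. 0 \<le> \<mu> A" and additive': "\<forall>A B. A \<inter> B = {} \<longrightarrow> \<mu> (A \<union> B) = \<mu> A + \<mu> B"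
      and invariant: "\<forall>g S. (\<forall>z z'. (\<forall>i<m. z i = z' i) \<longrightarrow> z \<in> S \<longrightarrow> z' \<in> S) \<longrightarrow>
         \<mu> {z. (\<lambda>i. act g (z i)) \<in> S} = \<mu> S"
      and box: "\<forall>U. (\<forall>i<m. open (U i) \<and> U i \<noteq> {}) \<longrightarrow> 0 < \<mu> {z. \<forall>i<m. z i \<in> U i}"
    using invariant_product_content[OF amenable, of m] by (elim exE conjE)
  have additive: "\<mu> (A \<union> B) = \<mu> A + \<mu> B" if "A \<inter> B = {}" for A B
    using additive' that by blast
  have diff: "\<mu> B = \<mu> A + \<mu> (B - A)" if "A \<subseteq> B" for A B
    using additive[of A "B - A"] that by (simp add: Un_absorb1)
  have mono: "\<mu> A \<le> \<mu> B" if "A \<subseteq> B" for A B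
    using diff[OF that] nonneg by simp
  have modular: "\<mu> (A \<union> B) + \<mu> (A \<inter> B) = \<mu> A + \<mu> B" for A B
  proof -
    have "\<mu> (A \<union> B) = \<mu> A + \<mu> (B - A)" using additive[of A "B - A"] by simp
    moreover have "\<mu> B = \<mu> (A \<inter> B) + \<mu> (B - A)" using diff[of "A \<inter> B" B]
      by (simp add: Diff_Int)
    ultimately show ?thesis by simp
  qed
  \<comment> \<open>As \<open>e\<close> decreases to 0, these sets shrink to the slice over
    \<open>y\<close> of the orbit closure of \<open>V \<times> W\<close>.\<close>
  define E where "E e y = {z. \<exists>g. \<exists>v\<in>V. \<exists>w. (\<forall>i<m. w i \<in> W i) \<and> dist (act g v) y < e \<and>
      (\<forall>i<m. dist (act g (w i)) (z i) < e)}" for e y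
  have E_cyl: "z \<in> E e y \<Longrightarrow> z' \<in> E e y" if "\<And>i. i < m \<Longrightarrow> z i = z' i" for z z' e y
    using that unfolding E_def by (simp add: mem_Collect_eq)
  have E_mono: "E e y \<subseteq> E e' y" if "e \<le> e'" for e e' y
  proof
    fix z assume "z \<in> E e y"
    then obtain g v w where "v \<in> V" "\<forall>i<m. w i \<in> W i" "dist (act g v) y < e"
      "\<forall>i<m. dist (act g (w i)) (z i) < e" by (auto simp: E_def)
    then show "z \<in> E e' y" unfolding E_def using less_le_trans[OF _ that] by blast
  qed
  have E_near: "E e y' \<subseteq> E (2 * e) y" if "dist y y' < e" for e y y'
  proof
    fix z assume "z \<in> E e y'"
    then obtain g v w where gvw: "v \<in> V" "\<forall>i<m. w i \<in> W i" "dist (act g v) y' < e"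
      "\<forall>i<m. dist (act g (w i)) (z i) < e" by (auto simp: E_def)
    have "dist (act g v) y < 2 * e"
      using gvw(3) that dist_triangle_less_add[of "act g v" y' e y e] by (simp add: dist_commute)
    moreover have "e > 0" using gvw(3) zero_le_dist[of "act g v" y'] by linarith
    then have "\<forall>i<m. dist (act g (w i)) (z i) < 2 * e"
      using gvw(4) by fastforce
    ultimately show "z \<in> E (2 * e) y" unfolding E_def using gvw(1,2) by blast
  qed
  \<comment> \<open>The content is only finitely additive, so an infimum over neighbourhoods stands
    for the content of the union of two slices.\<close>
  define \<psi> where "\<psi> y y' = (INF e\<in>{0<..}. \<mu> (E e y \<union> E e y'))" for y y'
  have bdd: "bdd_below ((\<lambda>e. \<mu> (E e y \<union> E e y')) ` {0<..})" for y y'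
    using nonneg by (auto intro: bdd_belowI)
  have \<psi>_le: "\<psi> y y' \<le> \<mu> (E e y \<union> E e y')" if "e > 0" for y y' e
    unfolding \<psi>_def using that by (intro cINF_lower[OF bdd]) auto
  have \<psi>_less: "\<exists>e>0. \<mu> (E e y \<union> E e y') < c" if "\<psi> y y' < c" for y y' c
    using that unfolding \<psi>_def by (subst (asm) cINF_less_iff[OF _ bdd]) auto
  have le_\<psi>: "c \<le> \<psi> y y'" if "\<And>e. e > 0 \<Longrightarrow> c \<le> \<mu> (E e y \<union> E e y')" for c y y'
    unfolding \<psi>_def using that by (intro cINF_greatest) auto
  have \<psi>_sym: "\<psi> y y' = \<psi> y' y" for y y' by (simp add: \<psi>_def Un_commute)
  \<comment> \<open>Uniform continuity of \<open>act h\<close> maps a \<open>d\<close>-neighbourhood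
    of a slice into an \<open>e\<close>-neighbourhood of the moved slice, and the content is
    invariant. The reverse inequality is the same statement for \<open>- h\<close>.\<close>
  have act_le: "\<psi> y y' \<le> \<psi> (act h y) (act h y')" for h y y'
  proof (rule le_\<psi>)
    fix e :: real assume "e > 0"
    then obtain d where d: "d > 0" "\<And>a b. dist a b < d \<Longrightarrow> dist (act h a) (act h b) < e"
      using compact_uniformly_continuous[OF continuous_act compact_X, of h]
      unfolding uniformly_continuous_on_def by (metis UNIV_I dist_commute)
    let ?S = "E e (act h y) \<union> E e (act h y')"
    have *: "(\<lambda>i. act h (z i)) \<in> E e (act h y)" if z: "z \<in> E d y" for z y
    proof -
      obtain g v w where gvw: "v \<in> V" "\<forall>i<m. w i \<in> W i" "dist (act g v) y < d"
        "\<forall>i<m. dist (act g (w i)) (z i) < d" using z by (auto simp: E_def)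
      then have "dist (act (h + g) v) (act h y) < e" "\<forall>i<m. dist (act (h + g) (w i)) (act h (z i)) < e"
        using d(2) by (auto simp: act_add)
      then show ?thesis unfolding E_def using gvw(1,2) by blast
    qed
    have "\<psi> y y' \<le> \<mu> (E d y \<union> E d y')" by (rule \<psi>_le[OF d(1)])
    also have "\<dots> \<le> \<mu> {z. (\<lambda>i. act h (z i)) \<in> ?S}" using * by (intro mono) auto
    also have "\<dots> = \<mu> ?S" by (intro invariant[rule_format]) (use E_cyl in blast)
    finally show "\<psi> y y' \<le> \<mu> ?S" .
  qed
  have \<psi>_inv: "\<psi> (act h y) (act h y') = \<psi> y y'" for h y y'
    using act_le[of y y' h] act_le[of "act h y" "act h y'" "- h"] by simp
  have usc: "\<exists>d>0. \<forall>y'. dist y y' < d \<longrightarrow> \<psi> y' y' < c \<and> \<psi> y y' < c" if yc: "\<psi> y y < c" for y c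
  proof -
    obtain e where e: "e > 0" "\<mu> (E e y) < c" using \<psi>_less[OF yc] by auto
    have "\<psi> y' y' < c \<and> \<psi> y y' < c" if "dist y y' < e/2" for y'
    proof -
      have "E (e/2) y' \<subseteq> E e y" "E (e/2) y \<subseteq> E e y"
        using E_near[OF that] E_mono[of "e/2" e y] e(1) by auto
      then have "\<mu> (E (e/2) y' \<union> E (e/2) y') \<le> \<mu> (E e y)" "\<mu> (E (e/2) y \<union> E (e/2) y') \<le> \<mu> (E e y)"
        by (intro mono; blast)+
      then show ?thesis
        using e \<psi>_le[of "e/2" y' y'] \<psi>_le[of "e/2" y y'] by linarith
    qed
    then show ?thesis using e(1) by (intro exI[of _ "e/2"]) auto
  qed
  \<comment> \<open>The orbit of \<open>y\<close> comes close to \<open>y'\<close>, where by upper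
    semicontinuity \<open>\<psi>\<close> would be smaller, against its invariance.\<close>
  have const: "\<psi> y y \<le> \<psi> y' y'" for y y'
  proof (rule ccontr)
    assume "\<not> ?thesis"
    then obtain d where d: "d > 0" "\<And>a. dist y' a < d \<Longrightarrow> \<psi> a a < \<psi> y y"
      using usc[of y' "\<psi> y y"] by force
    obtain g where "act g y \<in> ball y' d" using orbit_meets_open[of "ball y' d" y] d(1) by auto
    then show False using d(2)[of "act g y"] \<psi>_inv[of g y y] by auto
  qed
  define c where "c = \<psi> x x"
  have c: "\<psi> y y = c" for y using const[of x y] const[of y x] by (simp add: c_def)
  have lim: "\<psi> x x\<^sub>0 - c = 0"
  proof (rule pseudometric_factors_through_pi[of "\<lambda>y y'. \<psi> y y' - c"])
    show "\<psi> y y' - c = \<psi> y' y - c" for y y' by (simp add: \<psi>_sym)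
    \<comment> \<open>Modularity of the content: the union of \<open>?A\<close> and
      \<open>?B\<close> contains the neighbourhoods of the slices over \<open>y1\<close> and
      \<open>y3\<close>, while their intersection contains that over \<open>y2\<close>, of content
      at least \<open>c\<close>.\<close>
    show "\<psi> y1 y3 - c \<le> \<psi> y1 y2 - c + (\<psi> y2 y3 - c)" for y1 y2 y3
    proof (rule ccontr)
      assume "\<not> ?thesis"
      then have lt: "\<psi> y1 y2 + \<psi> y2 y3 < \<psi> y1 y3 + c" by simp
      define a where "a = (\<psi> y1 y3 + c - \<psi> y1 y2 - \<psi> y2 y3) / 2"
      have a: "a > 0" using lt by (simp add: a_def)
      obtain e1 where e1: "e1 > 0" "\<mu> (E e1 y1 \<union> E e1 y2) < \<psi> y1 y2 + a"
        using \<psi>_less[of y1 y2 "\<psi> y1 y2 + a"] a by auto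
      obtain e2 where e2: "e2 > 0" "\<mu> (E e2 y2 \<union> E e2 y3) < \<psi> y2 y3 + a"
        using \<psi>_less[of y2 y3 "\<psi> y2 y3 + a"] a by auto
      define e where "e = min e1 e2"
      have e: "e > 0" "e \<le> e1" "e \<le> e2" using e1 e2 by (auto simp: e_def)
      let ?A = "E e y1 \<union> E e y2" and ?B = "E e y2 \<union> E e y3"
      have "\<mu> ?A \<le> \<mu> (E e1 y1 \<union> E e1 y2)" "\<mu> ?B \<le> \<mu> (E e2 y2 \<union> E e2 y3)"
        using E_mono[OF e(2)] E_mono[OF e(3)] by (intro mono Un_mono; blast)+
      moreover have "\<psi> y1 y3 \<le> \<mu> (?A \<union> ?B)"
        using \<psi>_le[OF e(1), of y1 y3] mono[of "E e y1 \<union> E e y3" "?A \<union> ?B"] by force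
      moreover have "c \<le> \<mu> (?A \<inter> ?B)"
        using \<psi>_le[OF e(1), of y2 y2] c[of y2] mono[of "E e y2" "?A \<inter> ?B"] by force
      ultimately have "\<psi> y1 y3 + c < \<psi> y1 y2 + \<psi> y2 y3 + 2 * a"
        using modular[of ?A ?B] e1(2) e2(2) by linarith
      then show False by (simp add: a_def field_simps)
    qed
    show "\<exists>d>0. \<forall>y'. dist y y' < d \<longrightarrow> \<psi> y y' - c < e" if "e > 0" for y e
      using usc[of y "c + e"] c[of y] that by (auto simp: algebra_simps)
  qed (use c \<psi>_inv fibre in auto)
  show ?thesis
  proof (rule ccontr)
    \<comment> \<open>Without such a \<open>g\<close>, a box \<open>?B\<close> of positive content
      avoids the neighbourhoods of the slice over \<open>x\<close> but lies in all those over the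
      other point of the fibre, with witness \<open>g = 0\<close>. This makes \<open>\<psi>\<close>
      exceed \<open>c\<close> on the pair.\<close>
    assume no: "\<not> ?thesis"
    define w where "w i = (SOME a. a \<in> W i)" for i
    have w: "w i \<in> W i" if "i < m" for i
      using W[OF that] by (simp add: w_def some_in_eq)
    have "\<exists>e>0. ball x e \<subseteq> U" using U open_contains_ball by blast
    then obtain e0 where e0: "e0 > 0" "ball x e0 \<subseteq> U" by blast
    have "\<exists>r>0. i < m \<longrightarrow> ball (w i) r \<subseteq> W i" for i
      using W[of i] w[of i] by (cases "i < m") (auto simp: open_contains_ball intro: exI[of _ 1])
    then obtain r where r: "\<And>i. r i > 0" "\<And>i. i < m \<Longrightarrow> ball (w i) (r i) \<subseteq> W i" by metis
    \<comment> \<open>Half of the smallest radius leaves room for two errors: one inside the box,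
      one from the definition of \<open>E\<close>.\<close>
    define e where "e = Min (insert e0 (r ` {..<m})) / 2"
    have e: "e > 0" "2 * e \<le> e0" "\<And>i. i < m \<Longrightarrow> 2 * e \<le> r i"
      using e0(1) r(1) by (auto simp: e_def)
    let ?B = "{z. \<forall>i<m. z i \<in> ball (w i) e}"
    have pos: "0 < \<mu> ?B" using e(1) by (intro box[rule_format]) auto
    have disj: "?B \<inter> E d x = {}" if d: "d \<le> e" for d
    proof (rule ccontr)
      assume "?B \<inter> E d x \<noteq> {}"
      then obtain z g v u where z: "\<forall>i<m. z i \<in> ball (w i) e" and gvu: "v \<in> V" "\<forall>i<m. u i \<in> W i"
        "dist (act g v) x < d" "\<forall>i<m. dist (act g (u i)) (z i) < d" by (auto simp: E_def)
      have "act g v \<in> U" using gvu(3) d e(1,2) e0(2) by (auto simp: dist_commute subset_iff)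
      moreover have "act g (u i) \<in> W i" if "i < m" for i
      proof -
        have "dist (w i) (act g (u i)) < r i"
          using z gvu(4) that d e(3)[OF that] dist_triangle[of "w i" "act g (u i)" "z i"]
            dist_commute[of "z i" "act g (u i)"] by fastforce
        then show ?thesis using r(2)[OF that] by auto
      qed
      ultimately show False using no gvu(1,2) by blast
    qed
    have sub: "?B \<subseteq> E d x\<^sub>0" if "d > 0" for d
    proof
      fix z assume z: "z \<in> ?B"
      have "z i \<in> W i" if "i < m" for i
        using z that r(2)[OF that] e(1) e(3)[OF that] by (force simp: subset_iff)
      then show "z \<in> E d x\<^sub>0"
        unfolding E_def using V(2) \<open>d > 0\<close>
        by (auto intro!: exI[of _ 0] bexI[of _ x\<^sub>0] exI[of _ z])
    qed
    have "\<psi> x x\<^sub>0 < c + \<mu> ?B" using lim pos by simp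
    then obtain d1 where d1: "d1 > 0" "\<mu> (E d1 x \<union> E d1 x\<^sub>0) < c + \<mu> ?B" using \<psi>_less by blast
    define d where "d = min d1 e"
    have d: "d > 0" "d \<le> d1" "d \<le> e" using d1 e by (auto simp: d_def)
    have "c + \<mu> ?B \<le> \<mu> (E d x) + \<mu> ?B" using \<psi>_le[OF d(1), of x x] c[of x] by simp
    also have "\<dots> = \<mu> (E d x \<union> ?B)" using additive[of "E d x" ?B] disj[OF d(3)] by (simp add: Int_commute)
    also have "\<dots> \<le> \<mu> (E d1 x \<union> E d1 x\<^sub>0)"
      using E_mono[OF d(2)] sub[OF d1(1)] by (intro mono Un_mono; blast)
    finally show False using d1(2) by simp
  qed
qed

end

lemma finite_Union_closed_interior:
  assumes "finite \<C>" "\<And>C. C \<in> \<C> \<Longrightarrow> closed C" "interior (\<Union>\<C>) \<noteq> {}"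
  shows "\<exists>C\<in>\<C>. interior C \<noteq> {}"
  using assms
proof (induction \<C>)
  case (insert C \<C>)
  then show ?case
    using interior_closed_Un_empty_interior[of C "\<Union>\<C>"] by auto
qed simp

context mef_tds
begin

text \<open>A proper closed invariant subset of the factor would pull back to one of the extension.
  All facts on minimal systems thus become available for the factor.\<close>

sublocale Y: minimal_tds act'
proof
  have "compact (range \<pi>)" by (rule compact_continuous_image[OF continuous_pi compact_X])
  then have "compact (UNIV :: 'y set)" using surj_pi by simp
  moreover have "is_action act'"
    using max_eq unfolding max_eq_factor_def factor_map_def by blast
  ultimately show "tds act'"
    using tds by (simp add: tds_def)
  show "minimal_system act'"
    unfolding minimal_system_def minimal_set_def
  proof (intro conjI allI impI)
    show "invariant_set act' UNIV" by (simp add: invariant_set_def)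
    fix T :: "'y set" assume T: "T \<noteq> {} \<and> closed T \<and> T \<subseteq> UNIV \<and> invariant_set act' T"
    obtain y where "y \<in> T" using T by blast
    moreover obtain a where "y = \<pi> a" using surj_pi by (rule surjE)
    ultimately have "\<pi> -` T \<noteq> {}" by auto
    moreover have "closed (\<pi> -` T)"
      using T by (intro closed_vimage continuous_pi) blast
    moreover have "invariant_set act (\<pi> -` T)" 
      unfolding invariant_set_def
    proof (intro allI subsetI)
      fix g b assume "b \<in> act g ` (\<pi> -` T)"
      then obtain a where "b = act g a" "\<pi> a \<in> T" by auto
      then show "b \<in> \<pi> -` T" using T by (auto simp: invariant_set_def pi_act)
    qed
    moreover have "\<forall>S. S \<noteq> {} \<and> closed S \<and> S \<subseteq> UNIV \<and> invariant_set act S \<longrightarrow> S = UNIV"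
      using minimal unfolding minimal_system_def minimal_set_def by (elim conjE)
    ultimately have "\<pi> -` T = UNIV" by simp
    then show "T = UNIV" using surj_image_vimage_eq[OF surj_pi, of T] surj_pi by simp
  qed simp_all
qed

section \<open>The invariant metric on the factor and simultaneous hitting\<close>

definition rho :: "'y \<Rightarrow> 'y \<Rightarrow> real" where
  "rho y y' = (SUP g. dist (act' g y) (act' g y'))"

lemma bdd_rho: "bdd_above (range (\<lambda>g. dist (act' g y) (act' g y')))"
proof -
  have "bounded (UNIV :: 'y set)" using Y.compact_X by (rule compact_imp_bounded)
  then obtain B where "\<And>a b :: 'y. dist a b \<le> B" using bounded_two_points[of UNIV] by auto
  then show ?thesis by (intro bdd_aboveI[of _ B]) auto
qed

lemma dist_act_le_rho: "dist (act' g y) (act' g y') \<le> rho y y'"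
  unfolding rho_def by (intro cSUP_upper bdd_rho) simp

lemma dist_le_rho: "dist y y' \<le> rho y y'"
  using dist_act_le_rho[of 0] by simp

lemma rho_leI: "(\<And>g. dist (act' g y) (act' g y') \<le> c) \<Longrightarrow> rho y y' \<le> c"
  unfolding rho_def by (intro cSUP_least) auto

lemma rho_self [simp]: "rho y y = 0"
  by (simp add: rho_def)

lemma rho_commute: "rho y y' = rho y' y"
  by (simp add: rho_def dist_commute)

lemma rho_triangle: "rho a c \<le> rho a b + rho b c"
proof (rule rho_leI)
  fix g
  show "dist (act' g a) (act' g c) \<le> rho a b + rho b c"
    using dist_triangle[of "act' g a" "act' g c" "act' g b"]
      dist_act_le_rho[of g a b] dist_act_le_rho[of g b c] by linarith
qed

lemma rho_act [simp]: "rho (act' h a) (act' h b) = rho a b"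
proof -
  have le: "rho (act' h a) (act' h b) \<le> rho a b" for h a b
    by (rule rho_leI) (simp add: dist_act_le_rho flip: Y.act_add)
  show ?thesis using le[of h a b] le[of "- h" "act' h a" "act' h b"] by simp
qed

text \<open>Equicontinuity read as uniform equivalence of \<open>rho\<close> and
  \<open>dist\<close>; the bound \<open>e/2\<close> for each \<open>g\<close> keeps the supremum
  strictly below \<open>e\<close>.\<close>

lemma rho_uniform:
  assumes "e > 0"
  shows "\<exists>d>0. \<forall>y y'. dist y y' < d \<longrightarrow> rho y y' < e"
proof -
  have "equicontinuous_on UNIV act'" using max_eq unfolding max_eq_factor_def by blast
  then obtain d where d: "d > 0" "\<forall>y y'. dist y y' < d \<longrightarrow> (\<forall>g. dist (act' g y) (act' g y') < e/2)"
    unfolding equicontinuous_on_def using assms by (metis UNIV_I half_gt_zero)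
  have "rho y y' < e" if "dist y y' < d" for y y'
  proof -
    have "rho y y' \<le> e/2" using d(2) that by (intro rho_leI) (auto simp: less_imp_le)
    then show ?thesis using assms by simp
  qed
  then show ?thesis using d(1) by blast
qed

lemma open_rho_ball: "open {y'. rho y y' < e}"
  unfolding open_contains_ball
proof
  fix a assume a: "a \<in> {y'. rho y y' < e}"
  then have "e - rho y a > 0" by simp
  then obtain d where d: "d > 0" "\<And>b b'. dist b b' < d \<Longrightarrow> rho b b' < e - rho y a"
    using rho_uniform[of "e - rho y a"] by blast
  have "rho y b < e" if "b \<in> ball a d" for b
    using d(2)[of a b] that rho_triangle[of y b a] by auto
  then show "\<exists>d>0. ball a d \<subseteq> {y'. rho y y' < e}"
    using d(1) by (intro exI[of _ d]) auto
qed

lemma orbit_rho_dense: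
  assumes "e > 0"
  shows "\<exists>g. rho y (act' g z) < e"
  using Y.orbit_meets_open[OF open_rho_ball[of y e], of z] assms
  by (metis empty_iff mem_Collect_eq rho_self)

text \<open>Factor maps of minimal systems are semi-open: finitely many translates of the image of a
  closed ball in \<open>V\<close> cover the factor, so one of them, and hence the image itself, has
  interior. The centre \<open>z\<close> cannot be prescribed.\<close>

lemma image_open_contains_rho_ball:
  assumes "open V" "V \<noteq> {}"
  shows "\<exists>z. \<exists>\<eta>>0. {y. rho z y < \<eta>} \<subseteq> \<pi> ` V"
proof -
  obtain x where "x \<in> V" using assms(2) by blast
  then obtain e where x: "e > 0" "cball x e \<subseteq> V"
    using assms(1) open_contains_cball by blast
  obtain S where S: "finite S" "\<And>a. \<exists>s\<in>S. act s a \<in> ball x e"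
    using finite_return[of "ball x e"] x(1) by auto
  define C where "C s = act' (- s) ` \<pi> ` cball x e" for s
  have comp: "compact (\<pi> ` cball x e)"
    using compact_X continuous_pi
    by (metis closed_cball compact_Int_closed compact_continuous_image continuous_on_subset
        inf_top.left_neutral top_greatest)
  have "closed (C s)" for s
    unfolding C_def using comp Y.continuous_act
    by (metis compact_continuous_image compact_imp_closed continuous_on_subset top_greatest)
  moreover have "\<Union>(C ` S) = UNIV"
  proof -
    have "y \<in> \<Union>(C ` S)" for y
    proof -
      obtain a where a: "y = \<pi> a" using surj_pi by blast
      obtain s where s: "s \<in> S" "act s a \<in> cball x e" using S(2)[of a] by force
      have "y = act' (- s) (\<pi> (act s a))" using a by (simp add: pi_act)
      then show ?thesis using s unfolding C_def by blast
    qed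
    then show ?thesis by blast
  qed
  ultimately obtain s where "interior (C s) \<noteq> {}"
    using finite_Union_closed_interior[of "C ` S"] S(1) by auto
  then obtain y where y: "y \<in> interior (C s)" by blast
  let ?I = "act' s ` interior (C s)"
  have "open ?I" by (rule Y.open_image_act) simp
  moreover have "act' s y \<in> ?I" using y by simp
  ultimately obtain \<eta> where \<eta>: "\<eta> > 0" "ball (act' s y) \<eta> \<subseteq> ?I" using open_contains_ball by blast
  have "?I \<subseteq> act' s ` C s" using interior_subset by blast
  also have "\<dots> = \<pi> ` cball x e" by (simp add: C_def image_image)
  also have "\<dots> \<subseteq> \<pi> ` V" using x(2) by blast
  finally have "ball (act' s y) \<eta> \<subseteq> \<pi> ` V" using \<eta>(2) by blast
  moreover have "{b. rho (act' s y) b < \<eta>} \<subseteq> ball (act' s y) \<eta>"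
    by (auto intro: le_less_trans[OF dist_le_rho])
  ultimately show ?thesis using \<eta>(1) by blast
qed

lemma joint_return_finite:
  assumes fibre: "\<pi> x\<^sub>0 = \<pi> x" and V: "open V" "x\<^sub>0 \<in> V" and U: "open U" "x \<in> U"
    and W: "finite \<W>" "\<And>W. W \<in> \<W> \<Longrightarrow> open W \<and> W \<noteq> {}"
  shows "\<exists>g. act g ` V \<inter> U \<noteq> {} \<and> (\<forall>W\<in>\<W>. act g ` W \<inter> W \<noteq> {})"
proof -
  obtain n :: nat and f where f: "\<W> = f ` {i. i < n}"
    using finite_imp_nat_seg_image_inj_on[OF W(1)] by blast
  have fW: "open (f i) \<and> f i \<noteq> {}" if "i < n" for i
    using that by (intro W(2)) (simp add: f)
  have "\<exists>g. act g ` V \<inter> U \<noteq> {} \<and> (\<forall>i<n. act g ` f i \<inter> f i \<noteq> {})"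
    by (rule joint_return[OF fibre V U]) (rule fW)
  then obtain g where g: "act g ` V \<inter> U \<noteq> {}" "\<forall>i<n. act g ` f i \<inter> f i \<noteq> {}"
    by (elim exE conjE)
  have "act g ` W \<inter> W \<noteq> {}" if "W \<in> \<W>" for W
  proof -
    have "W \<in> f ` {i. i < n}" using \<open>W \<in> \<W>\<close> f by simp
    then obtain i where "i < n" "W = f i" by blast
    then show ?thesis using g(2) by simp
  qed
  then show ?thesis using g(1) by blast
qed

text \<open>A triple in \<open>T\<close> is a task: move \<open>V\<close>, whose image contains a
  ball about \<open>z\<close>, so that it meets \<open>U\<close>, which meets the fibre over
  \<open>z\<close>. Tasks are added one at a time. Since \<open>t\<close> nearly fixes
  \<open>z\<close>, the translate of \<open>V\<close> by \<open>t\<close> contains a point exactly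
  over \<open>z\<close>, and the joint return property moves it into \<open>U\<close> while it
  preserves the finished tasks and keeps all points of \<open>L\<close> nearly fixed.\<close>

lemma simultaneous_hitting:
  assumes "finite T" and L: "finite L" and \<eta>: "\<eta> > 0"
    and T: "\<And>V z U. (V, z, U) \<in> T \<Longrightarrow> z \<in> L \<and> open V \<and> {y. rho z y < \<eta>} \<subseteq> \<pi> ` V \<and> open U \<and> (\<exists>x\<in>U. \<pi> x = z)"
    and "\<eta>' > 0"
  shows "\<exists>t. (\<forall>z\<in>L. rho (act' t z) z < \<eta>') \<and> (\<forall>(V, z, U)\<in>T. act t ` V \<inter> U \<noteq> {})"
  using assms(1) T \<open>\<eta>' > 0\<close>
proof (induction T arbitrary: \<eta>')
  case empty
  then show ?case by (intro exI[of _ 0]) simp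
next
  case (insert q T)
  obtain V z U where q: "q = (V, z, U)" by (cases q)
  have q': "z \<in> L" "open V" "{y. rho z y < \<eta>} \<subseteq> \<pi> ` V" "open U" "\<exists>x\<in>U. \<pi> x = z"
    using insert.prems(1)[of V z U] q by auto
  then obtain x where x: "x \<in> U" "\<pi> x = z" by blast
  \<comment> \<open>Being below \<open>\<eta>\<close>, it puts the preimage of \<open>z\<close>
    under \<open>t\<close> into the image of \<open>V\<close>; being at most half of
    \<open>\<eta>'\<close>, it lets the displacements by \<open>t\<close> and by the new
    \<open>g\<close> add up.\<close>
  define \<theta> where "\<theta> = min \<eta>' \<eta> / 2"
  have \<theta>: "\<theta> > 0" "\<theta> < \<eta>" "2 * \<theta> \<le> \<eta>'" using \<eta> insert.prems(2) by (auto simp: \<theta>_def)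
  have T': "\<And>V z U. (V, z, U) \<in> T \<Longrightarrow> z \<in> L \<and> open V \<and> {y. rho z y < \<eta>} \<subseteq> \<pi> ` V \<and> open U \<and> (\<exists>x\<in>U. \<pi> x = z)"
    using insert.prems(1) by blast
  have "\<exists>t. (\<forall>z\<in>L. rho (act' t z) z < \<theta>) \<and> (\<forall>(V, z, U)\<in>T. act t ` V \<inter> U \<noteq> {})"
    by (rule insert.IH[OF T' \<theta>(1)])
  then obtain t where t: "\<forall>z\<in>L. rho (act' t z) z < \<theta>"
    and t': "\<forall>(V, z, U)\<in>T. act t ` V \<inter> U \<noteq> {}" by (elim exE conjE)
  have "rho z (act' (- t) z) < \<eta>"
    using t[rule_format, OF q'(1)] \<theta>(2) rho_act[of t z "act' (- t) z"] by simp
  then obtain v where v: "v \<in> V" "\<pi> v = act' (- t) z" using q'(3) by (metis (mono_tags) imageE mem_Collect_eq subsetD)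
  have x0: "act t v \<in> act t ` V" "\<pi> (act t v) = \<pi> x" using v x by (auto simp: pi_act)
  \<comment> \<open>Returns of the first kind of set preserve the finished tasks. Returns of the
    second kind displace each point of \<open>L\<close> by less than \<open>\<theta>\<close>, half
    of it on either side because \<open>rho\<close> is invariant.\<close>
  define \<W> where "\<W> = (\<lambda>(V, z, U). U \<inter> act t ` V) ` T \<union> (\<lambda>z. \<pi> -` {y. rho z y < \<theta> / 2}) ` L"
  have fin: "finite \<W>" using insert.hyps(1) L by (simp add: \<W>_def)
  have ne: "open W \<and> W \<noteq> {}" if "W \<in> \<W>" for W
    using that unfolding \<W>_def
  proof
    assume "W \<in> (\<lambda>(V, z, U). U \<inter> act t ` V) ` T"
    then obtain V z U where VU: "(V, z, U) \<in> T" "W = U \<inter> act t ` V" by auto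
    then have "open U" "open V" using T'[OF VU(1)] by simp_all
    moreover have "act t ` V \<inter> U \<noteq> {}" using bspec[OF t' VU(1)] by simp
    ultimately show ?thesis using open_image_act[of V t] VU(2) by (simp add: open_Int Int_commute)
  next
    assume "W \<in> (\<lambda>z. \<pi> -` {y. rho z y < \<theta> / 2}) ` L"
    then obtain z where W: "W = \<pi> -` {y. rho z y < \<theta> / 2}" by blast
    obtain a where "z = \<pi> a" using surj_pi by (rule surjE)
    then have "a \<in> W" using W \<theta>(1) by simp
    moreover have "open W" unfolding W by (rule open_vimage_pi[OF open_rho_ball])
    ultimately show ?thesis by auto
  qed
  have "\<exists>g. act g ` act t ` V \<inter> U \<noteq> {} \<and> (\<forall>W\<in>\<W>. act g ` W \<inter> W \<noteq> {})"
    by (rule joint_return_finite[OF x0(2) open_image_act[OF q'(2)] x0(1) q'(4) x(1) fin]) (rule ne)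
  then obtain g where g: "act g ` act t ` V \<inter> U \<noteq> {}" "\<forall>W\<in>\<W>. act g ` W \<inter> W \<noteq> {}"
    by (elim exE conjE)
  have im: "act (g + t) ` V = act g ` act t ` V" for V by (simp add: image_image act_add)
  show ?case
  proof (intro exI[of _ "g + t"] conjI ballI)
    fix b assume b: "b \<in> L"
    then have "\<pi> -` {y. rho b y < \<theta> / 2} \<in> \<W>" by (simp add: \<W>_def)
    from bspec[OF g(2) this] obtain a where a: "rho b (\<pi> a) < \<theta> / 2" "rho b (act' g (\<pi> a)) < \<theta> / 2"
      by (auto simp: pi_act)
    have "rho (act' g b) b \<le> rho (act' g b) (act' g (\<pi> a)) + rho (act' g (\<pi> a)) b"
      by (rule rho_triangle)
    also have "\<dots> < \<theta>" using a by (simp add: rho_commute)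
    finally have "rho (act' g b) b < \<theta>" .
    moreover have "rho (act' g (act' t b)) b \<le> rho (act' g (act' t b)) (act' g b) + rho (act' g b) b"
      by (rule rho_triangle)
    ultimately show "rho (act' (g + t) b) b < \<eta>'"
      using t[rule_format, OF b] \<theta>(3) by (simp add: Y.act_add)
  next
    fix r assume "r \<in> insert q T"
    then show "case r of (V, z, U) \<Rightarrow> act (g + t) ` V \<inter> U \<noteq> {}"
    proof
      assume "r = q"
      then show ?thesis using g(1) by (simp add: q im)
    next
      assume "r \<in> T"
      then obtain V' z' U' where r: "r = (V', z', U')" "(V', z', U') \<in> T" by (cases r) auto
      then have "U' \<inter> act t ` V' \<in> \<W>" by (force simp: \<W>_def)
      from bspec[OF g(2) this] show ?thesis by (auto simp: r im)
    qed
  qed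
qed

end

section \<open>Equidistribution on the factor\<close>

locale mef_measure = mef_tds act act' \<pi>
  for act :: "'g::group_add \<Rightarrow> 'x::metric_space \<Rightarrow> 'x" and act' :: "'g \<Rightarrow> 'y::metric_space \<Rightarrow> 'y" and \<pi> +
  fixes \<nu> :: "'y measure"
  assumes inv_prob: "invariant_prob act' \<nu>"
begin

sublocale prob_space \<nu>
  using inv_prob by (simp add: invariant_prob_def)

lemma sets_nu [simp, measurable_cong]: "sets \<nu> = sets borel"
  using inv_prob by (simp add: invariant_prob_def)

lemma space_nu [simp]: "space \<nu> = UNIV"
  using sets_eq_imp_space_eq[OF sets_nu] by simp

lemma measurable_act [measurable]: "act' g \<in> measurable \<nu> \<nu>"
  using borel_measurable_continuous_onI[OF Y.continuous_act, of g]
  by (simp cong: measurable_cong_sets)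

lemma distr_act: "distr \<nu> \<nu> (act' g) = \<nu>"
proof (rule measure_eqI)
  fix A assume "A \<in> sets (distr \<nu> \<nu> (act' g))"
  then have A: "A \<in> sets borel" by simp
  then have "emeasure \<nu> (act' g -` A) = emeasure \<nu> A"
    using inv_prob by (auto simp: invariant_prob_def)
  then show "emeasure (distr \<nu> \<nu> (act' g)) A = emeasure \<nu> A"
    using A by (simp add: emeasure_distr)
qed simp

lemma integral_act:
  fixes f :: "'y \<Rightarrow> real"
  assumes "f \<in> borel_measurable borel"
  shows "(\<integral>y. f (act' g y) \<partial>\<nu>) = (\<integral>y. f y \<partial>\<nu>)"
proof -
  have "f \<in> borel_measurable \<nu>" using assms by simp
  then have "(\<integral>y. f y \<partial>distr \<nu> \<nu> (act' g)) = (\<integral>y. f (act' g y) \<partial>\<nu>)"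
    by (intro integral_distr) auto
  then show ?thesis by (simp add: distr_act)
qed

lemma integrable_bounded:
  fixes f :: "'y \<Rightarrow> real"
  assumes "f \<in> borel_measurable borel" "\<And>y. \<bar>f y\<bar> \<le> B"
  shows "integrable \<nu> f"
  using assms by (intro integrable_const_bound[of _ B]) auto

lemma continuous_bounded:
  fixes f :: "'y \<Rightarrow> real"
  assumes "continuous_on UNIV f"
  shows "\<exists>B. \<forall>y. \<bar>f y\<bar> \<le> B"
  using compact_imp_bounded[OF compact_continuous_image[OF assms Y.compact_X]]
  by (auto simp: bounded_iff)

lemma measurable_continuous:
  fixes f :: "'y \<Rightarrow> real"
  shows "continuous_on UNIV f \<Longrightarrow> f \<in> borel_measurable borel"
  by (rule borel_measurable_continuous_onI)

text \<open>Finitely many preimages of \<open>U\<close> cover the factor; by invariance they would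
  all be null.\<close>

lemma open_pos:
  assumes "open U" "U \<noteq> {}"
  shows "0 < measure \<nu> U"
proof (rule ccontr)
  assume "\<not> ?thesis"
  then have "measure \<nu> U = 0" using measure_nonneg[of \<nu> U] by linarith
  then have U0: "emeasure \<nu> U = 0" by (simp add: emeasure_eq_measure)
  obtain S where S: "finite S" "\<forall>y. \<exists>s\<in>S. act' s y \<in> U"
    using Y.finite_return[OF assms] by blast
  have "act' s -` U \<in> null_sets \<nu>" for s
    using inv_prob U0 assms(1) Y.open_vimage_act[OF assms(1), of s]
    by (intro null_setsI) (auto simp: invariant_prob_def)
  then have "(\<Union>s\<in>S. act' s -` U) \<in> null_sets \<nu>"
    using S(1) by (intro null_sets_UN') (auto simp: countable_finite)
  moreover have "(\<Union>s\<in>S. act' s -` U) = UNIV" using S(2) by blast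
  ultimately have "emeasure \<nu> (space \<nu>) = 0" by auto
  then show False by (simp add: emeasure_space_1 del: space_nu)
qed

lemma rho_uniformly_continuous:
  fixes f :: "'y \<Rightarrow> real"
  assumes "continuous_on UNIV f" "e > 0"
  shows "\<exists>d>0. \<forall>y y'. rho y y' < d \<longrightarrow> \<bar>f y - f y'\<bar> < e"
proof -
  have "uniformly_continuous_on UNIV f"
    by (rule compact_uniformly_continuous[OF assms(1) Y.compact_X])
  then obtain d where d: "d > 0" "\<forall>y\<in>UNIV. \<forall>y'\<in>UNIV. dist y' y < d \<longrightarrow> dist (f y') (f y) < e"
    unfolding uniformly_continuous_on_def using assms(2) by metis
  have "\<bar>f y - f y'\<bar> < e" if "rho y y' < d" for y y'
    using d(2) le_less_trans[OF dist_le_rho that] by (simp add: dist_real_def)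
  then show ?thesis using d(1) by blast
qed

text \<open>If \<open>F\<close> is left Folner then averaging over the inverses of \<open>F\<close> is nearly invariant under
  right translation, hence nearly constant along an orbit; equicontinuity makes this uniform.\<close>
lemma almost_constant_average:
  fixes f :: "'y \<Rightarrow> real"
  assumes f: "continuous_on UNIV f" and e: "e > 0"
  shows "\<exists>S c. finite S \<and> S \<noteq> {} \<and> (\<forall>y. \<bar>favg S (\<lambda>s. f (act' s y)) - c\<bar> \<le> e)"
proof -
  obtain F :: "nat \<Rightarrow> 'g set" where F: "folner F" using amenable by (auto simp: amenable_def)
  obtain B where B: "\<forall>y. \<bar>f y\<bar> \<le> B" using continuous_bounded[OF f] by blast
  obtain \<theta> where \<theta>: "\<theta> > 0" "\<forall>y y'. rho y y' < \<theta> \<longrightarrow> \<bar>f y - f y'\<bar> < e/2"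
    using rho_uniformly_continuous[OF f, of "e/2"] e by auto
  fix y0 :: 'y
  have "UNIV \<subseteq> (\<Union>h\<in>UNIV. {y. rho (act' h y0) y < \<theta>})"
    using orbit_rho_dense[OF \<theta>(1), of _ y0] by (auto simp: rho_commute)
  then obtain H where H: "finite H" "UNIV \<subseteq> (\<Union>h\<in>H. {y. rho (act' h y0) y < \<theta>})"
    using compactE_image[OF Y.compact_X, of UNIV "\<lambda>h. {y. rho (act' h y0) y < \<theta>}"] open_rho_ball by metis
  define \<phi> where "\<phi> s = f (act' (- s) y0)" for s
  have \<phi>: "\<bar>\<phi> s\<bar> \<le> B" for s using B by (simp add: \<phi>_def)
  have "eventually (\<lambda>n. \<forall>h\<in>H. \<bar>favg (F n) (\<lambda>s. \<phi> (- h + s)) - favg (F n) \<phi>\<bar> < e/2) sequentially"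
  proof (rule eventually_ball_finite[OF H(1)], rule ballI)
    fix h
    show "eventually (\<lambda>n. \<bar>favg (F n) (\<lambda>s. \<phi> (- h + s)) - favg (F n) \<phi>\<bar> < e/2) sequentially"
      using tendstoD[OF folner_favg_translate[where h = "- h" and \<phi> = \<phi>, OF F \<phi>] half_gt_zero[OF e]]
      by (simp add: dist_real_def)
  qed
  then obtain N where N: "\<forall>h\<in>H. \<bar>favg (F N) (\<lambda>s. \<phi> (- h + s)) - favg (F N) \<phi>\<bar> < e/2"
    by (auto simp: eventually_sequentially)
  have fin: "finite (F N)" "F N \<noteq> {}" by (rule folner_finite[OF F])+
  have "\<bar>favg (uminus ` F N) (\<lambda>s. f (act' s y)) - favg (F N) \<phi>\<bar> \<le> e" for y
  proof -
    obtain h where h: "h \<in> H" "rho (act' h y0) y < \<theta>" using H(2) by blast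
    have eq: "favg (uminus ` F N) (\<lambda>s. f (act' s y)) = favg (F N) (\<lambda>s. f (act' (- s) y))"
      by (rule favg_image) (simp add: inj_on_def)
    \<comment> \<open>Evaluation at inverses turns the change of base point by \<open>h\<close> into
      a left translation of \<open>\<phi>\<close>, which is harmless along \<open>F N\<close>.
      Replacing \<open>y\<close> by \<open>act' h y0\<close> costs at most \<open>e/2\<close> for
      all \<open>s\<close> at once.\<close>
    have "\<phi> (- h + s) = f (act' (- s) (act' h y0))" for s
      by (simp add: \<phi>_def minus_add flip: Y.act_add)
    then have "\<bar>f (act' (- s) y) - \<phi> (- h + s)\<bar> \<le> e/2" for s
      using \<theta>(2)[rule_format, of "act' (- s) y" "act' (- s) (act' h y0)"] h(2)
      by (simp add: rho_commute less_imp_le)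
    then have "\<bar>favg (F N) (\<lambda>s. f (act' (- s) y) - \<phi> (- h + s))\<bar> \<le> e/2"
      by (intro favg_abs_le fin)
    then show ?thesis
      using bspec[OF N h(1)] unfolding eq favg_diff by linarith
  qed
  then show ?thesis
    using fin by (intro exI[of _ "uminus ` F N"] exI[of _ "favg (F N) \<phi>"]) auto
qed

text \<open>The almost constant average over \<open>S\<close> has value near \<open>c\<close>, and
  by invariance of \<open>\<nu>\<close> it has the same integral as \<open>f\<close>, so
  \<open>c\<close> is near the integral. Inserting the average over \<open>S\<close> into the one
  over \<open>F n\<close> changes little by the Folner property. The limit shows that the integral
  is the same for every invariant measure.\<close>

lemma folner_equidistribution:
  fixes f :: "'y \<Rightarrow> real"
  assumes f: "continuous_on UNIV f" and F: "folner F"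
  shows "(\<lambda>n. favg (F n) (\<lambda>g. f (act' g z))) \<longlonglongrightarrow> (\<integral>y. f y \<partial>\<nu>)"
proof (rule tendstoI)
  fix e :: real assume "e > 0"
  then have e: "e/4 > 0" by simp
  obtain B where B: "\<forall>y. \<bar>f y\<bar> \<le> B" using continuous_bounded[OF f] by blast
  obtain S c where S: "finite S" "S \<noteq> {}" "\<forall>y. \<bar>favg S (\<lambda>s. f (act' s y)) - c\<bar> \<le> e/4"
    using almost_constant_average[OF f e] by (elim exE conjE)
  have meas: "f \<in> borel_measurable borel" by (rule measurable_continuous[OF f])
  have meas_s: "(\<lambda>y. f (act' s y)) \<in> borel_measurable borel" for s
    using measurable_compose[OF borel_measurable_continuous_onI[OF Y.continuous_act] meas] .
  have int_s: "integrable \<nu> (\<lambda>y. f (act' s y))" for s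
    using B by (intro integrable_bounded[OF meas_s, of _ B]) auto
  have int: "integrable \<nu> (\<lambda>y. favg S (\<lambda>s. f (act' s y)))"
    unfolding favg_def using int_s by auto
  have "(\<integral>y. favg S (\<lambda>s. f (act' s y)) \<partial>\<nu>) = favg S (\<lambda>s. \<integral>y. f (act' s y) \<partial>\<nu>)"
    unfolding favg_def using int_s by simp
  also have "\<dots> = (\<integral>y. f y \<partial>\<nu>)"
    using S by (simp add: integral_act[OF meas] favg_const)
  finally have eq: "(\<integral>y. favg S (\<lambda>s. f (act' s y)) \<partial>\<nu>) = (\<integral>y. f y \<partial>\<nu>)" .
  have bd: "c - e/4 \<le> favg S (\<lambda>s. f (act' s y))" "favg S (\<lambda>s. f (act' s y)) \<le> c + e/4" for y
    using S(3)[rule_format, of y] by linarith+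
  have "c - e/4 \<le> (\<integral>y. f y \<partial>\<nu>)" "(\<integral>y. f y \<partial>\<nu>) \<le> c + e/4"
    using integral_ge_const[OF int, of "c - e/4"] integral_le_const[OF int, of "c + e/4"] bd
    by (simp_all add: eq)
  then have c1: "\<bar>(\<integral>y. f y \<partial>\<nu>) - c\<bar> \<le> e/4" by linarith
  define \<phi> where "\<phi> g = f (act' g z)" for g
  have \<phi>: "\<bar>\<phi> s\<bar> \<le> B" for s using B by (simp add: \<phi>_def)
  have "eventually (\<lambda>n. \<forall>s\<in>S. \<bar>favg (F n) (\<lambda>g. \<phi> (s + g)) - favg (F n) \<phi>\<bar> < e/4) sequentially"
  proof (rule eventually_ball_finite[OF S(1)], rule ballI)
    fix s
    show "eventually (\<lambda>n. \<bar>favg (F n) (\<lambda>g. \<phi> (s + g)) - favg (F n) \<phi>\<bar> < e/4) sequentially"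
      using tendstoD[OF folner_favg_translate[where h = s and \<phi> = \<phi>, OF F \<phi>] e]
      by (simp add: dist_real_def)
  qed
  then show "eventually (\<lambda>n. dist (favg (F n) (\<lambda>g. f (act' g z))) (\<integral>y. f y \<partial>\<nu>) < e) sequentially"
  proof (rule eventually_mono)
    fix n assume n: "\<forall>s\<in>S. \<bar>favg (F n) (\<lambda>g. \<phi> (s + g)) - favg (F n) \<phi>\<bar> < e/4"
    note fin = folner_finite[OF F, of n]
    have "\<bar>favg S (\<lambda>s. favg (F n) (\<lambda>g. \<phi> (s + g)) - favg (F n) \<phi>)\<bar> \<le> e/4"
      using n by (intro favg_abs_le S) (auto simp: less_imp_le)
    then have 1: "\<bar>favg (F n) (\<lambda>g. favg S (\<lambda>s. \<phi> (s + g))) - favg (F n) \<phi>\<bar> \<le> e/4"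
      by (subst favg_swap) (simp add: favg_diff favg_const S)
    have "\<bar>favg (F n) (\<lambda>g. favg S (\<lambda>s. \<phi> (s + g)) - c)\<bar> \<le> e/4"
      using S(3) by (intro favg_abs_le fin) (simp add: \<phi>_def Y.act_add)
    then have 2: "\<bar>favg (F n) (\<lambda>g. favg S (\<lambda>s. \<phi> (s + g))) - c\<bar> \<le> e/4"
      by (simp add: favg_diff favg_const fin)
    have "\<bar>favg (F n) \<phi> - (\<integral>y. f y \<partial>\<nu>)\<bar> < e" using 1 2 c1 e by linarith
    then show "dist (favg (F n) (\<lambda>g. f (act' g z))) (\<integral>y. f y \<partial>\<nu>) < e"
      by (simp add: dist_real_def \<phi>_def[abs_def])
  qed
qed

text \<open>Continuity from above along the levels \<open>1/(n+1)\<close>, whose sublevel sets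
  intersect in the zero set.\<close>

lemma measure_sublevel:
  fixes h :: "'y \<Rightarrow> real"
  assumes h: "continuous_on UNIV h" and nonneg: "\<And>y. 0 \<le> h y" and d: "d > 0"
  shows "\<exists>e>0. measure \<nu> {y. h y \<le> e} < measure \<nu> {y. h y = 0} + d"
proof -
  let ?A = "\<lambda>n::nat. {y. h y \<le> inverse (real (Suc n))}"
  have "range ?A \<subseteq> sets \<nu>"
    using h by (auto intro!: borel_closed closed_Collect_le continuous_on_const)
  moreover have "decseq ?A"
  proof (rule decseq_SucI, rule Collect_mono, rule impI)
    fix n y assume "h y \<le> inverse (real (Suc (Suc n)))"
    also have "\<dots> \<le> inverse (real (Suc n))" by (rule le_imp_inverse_le) simp_all
    finally show "h y \<le> inverse (real (Suc n))" .
  qed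
  ultimately have "(\<lambda>n. measure \<nu> (?A n)) \<longlonglongrightarrow> measure \<nu> (\<Inter>n. ?A n)"
    by (rule finite_Lim_measure_decseq)
  moreover have "(\<Inter>n. ?A n) = {y. h y = 0}"
  proof -
    have "h y = 0" if "\<forall>n. h y \<le> inverse (real (Suc n))" for y
    proof (rule ccontr)
      assume "h y \<noteq> 0"
      then have "h y > 0" using nonneg[of y] by simp
      then obtain n where "inverse (real (Suc n)) < h y" using reals_Archimedean by blast
      then show False using that by (simp add: not_le[symmetric] del: of_nat_Suc)
    qed
    then show ?thesis by auto
  qed
  ultimately have "(\<lambda>n. measure \<nu> (?A n)) \<longlonglongrightarrow> measure \<nu> {y. h y = 0}" by simp
  then have "eventually (\<lambda>n. measure \<nu> (?A n) < measure \<nu> {y. h y = 0} + d) sequentially"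
    by (rule order_tendstoD) (use d in simp)
  then obtain n where "measure \<nu> (?A n) < measure \<nu> {y. h y = 0} + d"
    by (auto simp: eventually_sequentially)
  then show ?thesis by (intro exI[of _ "inverse (real (Suc n))"]) simp
qed

text \<open>The supremum over all Folner sequences is harmless because the averages of
  \<open>f\<close> have the same limit along each of them.\<close>

lemma upper_BD_le_integral:
  fixes f :: "'y \<Rightarrow> real"
  assumes f: "continuous_on UNIV f" and nonneg: "\<And>y. 0 \<le> f y" and S: "\<And>g. g \<in> S \<Longrightarrow> 1 \<le> f (act' g z)"
  shows "upper_BD S \<le> ereal (\<integral>y. f y \<partial>\<nu>)"
  unfolding upper_BD_def
proof (rule SUP_least)
  fix F :: "nat \<Rightarrow> 'g set" assume "F \<in> {F. folner F}"
  then have F: "folner F" by simp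
  have "real (card (F n \<inter> S)) / real (card (F n)) \<le> favg (F n) (\<lambda>g. f (act' g z))" for n
    unfolding favg_indicator[OF folner_finite(1)[OF F], symmetric]
    using S nonneg by (intro favg_mono) (auto simp: indicator_def)
  then have "limsup (\<lambda>n. ereal (real (card (F n \<inter> S)) / real (card (F n))))
      \<le> limsup (\<lambda>n. ereal (favg (F n) (\<lambda>g. f (act' g z))))"
    by (intro Limsup_mono always_eventually) simp
  also have "\<dots> = ereal (\<integral>y. f y \<partial>\<nu>)"
    using folner_equidistribution[OF f F, of z] by (intro lim_imp_Limsup) auto
  finally show "limsup (\<lambda>n. ereal (real (card (F n \<inter> S)) / real (card (F n)))) \<le> ereal (\<integral>y. f y \<partial>\<nu>)" .
qed

section \<open>Measures of common images and upper Banach density\<close>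

definition common_image :: "nat \<Rightarrow> (nat \<Rightarrow> 'x set) \<Rightarrow> 'y set" where
  "common_image K B = {y. \<forall>k<K. y \<in> \<pi> ` B k}"

lemma closed_image_pi: "closed C \<Longrightarrow> closed (\<pi> ` C)"
proof -
  assume "closed C"
  then have "compact C" using compact_X compact_Int_closed[of UNIV C] by simp
  then show ?thesis
    using continuous_pi by (intro compact_imp_closed compact_continuous_image) (auto intro: continuous_on_subset)
qed

lemma closed_common_image: "(\<And>k. k < K \<Longrightarrow> closed (B k)) \<Longrightarrow> closed (common_image K B)"
proof -
  assume "\<And>k. k < K \<Longrightarrow> closed (B k)"
  then have "closed (\<Inter>k\<in>{..<K}. \<pi> ` B k)" by (intro closed_INT ballI closed_image_pi) simp
  moreover have "common_image K B = (\<Inter>k\<in>{..<K}. \<pi> ` B k)" by (auto simp: common_image_def)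
  ultimately show ?thesis by simp
qed

text \<open>If the common image were null, it would have a neighbourhood of measure below
  \<open>\<delta>\<close>. When \<open>V\<close> is the preimage of a small \<open>rho\<close>-ball
  about \<open>y0\<close>, a \<open>g\<close> that moves \<open>V\<close> to meet all
  \<open>B k\<close> puts \<open>act' g y0\<close> into that neighbourhood, so such \<open>g\<close>
  have upper density below \<open>\<delta>\<close>.\<close>

lemma wms_tuple_common_image_pos:
  assumes wms: "wms_tuple act K xs" and B: "\<And>k. k < K \<Longrightarrow> open (B k) \<and> xs k \<in> B k"
  shows "0 < measure \<nu> (common_image K (\<lambda>k. closure (B k)))"
proof (rule ccontr)
  assume "\<not> ?thesis"
  then have zero: "measure \<nu> (common_image K (\<lambda>k. closure (B k))) = 0"
    using measure_nonneg[of \<nu> "common_image K (\<lambda>k. closure (B k))"] by linarith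
  have "\<exists>\<delta>>0. \<forall>V. open V \<and> V \<noteq> {} \<longrightarrow> upper_BD {g. \<forall>k<K. act g ` V \<inter> B k \<noteq> {}} > ereal \<delta>"
    using spec[OF wms[unfolded wms_tuple_def], of B] B by simp
  then obtain \<delta> :: real where \<delta>: "\<delta> > 0"
    "\<forall>V. open V \<and> V \<noteq> {} \<longrightarrow> upper_BD {g. \<forall>k<K. act g ` V \<inter> B k \<noteq> {}} > ereal \<delta>"
    by (elim exE conjE)
  define h where "h y = (\<Sum>k<K. infdist y (\<pi> ` closure (B k)))" for y
  have h: "continuous_on UNIV h" unfolding h_def by (intro continuous_intros)
  have hnn: "0 \<le> h y" for y by (auto simp: h_def infdist_nonneg intro: sum_nonneg)
  have "h y = 0 \<longleftrightarrow> (\<forall>k<K. infdist y (\<pi> ` closure (B k)) = 0)" for y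
    unfolding h_def by (subst sum_nonneg_eq_0_iff) (auto simp: infdist_nonneg)
  moreover have "infdist y (\<pi> ` closure (B k)) = 0 \<longleftrightarrow> y \<in> \<pi> ` closure (B k)" if "k < K" for k y
    using B[OF that] by (intro in_closed_iff_infdist_zero[symmetric] closed_image_pi) auto
  ultimately have A: "{y. h y = 0} = common_image K (\<lambda>k. closure (B k))"
    by (auto simp: common_image_def)
  obtain e where e: "e > 0" "measure \<nu> {y. h y \<le> e} < \<delta>"
    using measure_sublevel[OF h hnn \<delta>(1)] zero by (auto simp: A)
  \<comment> \<open>This function is 1 for \<open>h\<close> up to \<open>e/2\<close> and 0 from
    \<open>e\<close> on.\<close>
  define f where "f y = max 0 (min 1 (2 - 2 * h y / e))" for y
  have f: "continuous_on UNIV f" unfolding f_def using e(1) by (intro continuous_intros h) auto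
  have fle: "f y \<le> indicator {y. h y \<le> e} y" for y
    using e(1) by (auto simp: f_def indicator_def field_simps)
  have meas: "{y. h y \<le> e} \<in> sets \<nu>"
    using h by (auto intro!: borel_closed closed_Collect_le continuous_on_const)
  have "(\<integral>y. f y \<partial>\<nu>) \<le> (\<integral>y. indicator {y. h y \<le> e} y \<partial>\<nu>)"
  proof (rule integral_mono[OF _ _ fle])
    show "integrable \<nu> f" by (rule integrable_bounded[OF measurable_continuous[OF f], of 1]) (simp add: f_def)
    show "integrable \<nu> (indicator {y. h y \<le> e} :: 'y \<Rightarrow> real)"
      using meas by (intro integrable_real_indicator) (auto simp: emeasure_eq_measure)
  qed
  also have "\<dots> = measure \<nu> {y. h y \<le> e}" using meas by simp
  finally have fint: "(\<integral>y. f y \<partial>\<nu>) < \<delta>" using e(2) by linarith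
  fix y0 :: 'y
  \<comment> \<open>\<open>K\<close> summands of size \<open>r\<close> stay within
    \<open>e/2\<close>; the added 1 covers \<open>K = 0\<close>.\<close>
  define r where "r = e / (2 * (real K + 1))"
  have r: "r > 0" "real K * r \<le> e / 2" using e(1) by (auto simp: r_def field_simps)
  define V where "V = \<pi> -` {y. rho y0 y < r}"
  have oV: "open V" unfolding V_def by (rule open_vimage_pi[OF open_rho_ball])
  obtain a where "y0 = \<pi> a" using surj_pi by (rule surjE)
  then have "a \<in> V" using r(1) by (simp add: V_def)
  then have V: "open V \<and> V \<noteq> {}" using oV by blast
  have "upper_BD {g. \<forall>k<K. act g ` V \<inter> B k \<noteq> {}} \<le> ereal (\<integral>y. f y \<partial>\<nu>)"
  proof (rule upper_BD_le_integral[OF f])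
    show "0 \<le> f y" for y by (simp add: f_def)
    fix g assume g: "g \<in> {g. \<forall>k<K. act g ` V \<inter> B k \<noteq> {}}"
    have "infdist (act' g y0) (\<pi> ` closure (B k)) \<le> r" if k: "k < K" for k
    proof -
      obtain v where v: "v \<in> V" "act g v \<in> B k" using g k by blast
      have "infdist (act' g y0) (\<pi> ` closure (B k)) \<le> dist (act' g y0) (\<pi> (act g v))"
        using v(2) closure_subset[of "B k"] by (intro infdist_le) auto
      also have "\<dots> \<le> rho (act' g y0) (act' g (\<pi> v))" by (simp only: pi_act dist_le_rho)
      also have "\<dots> \<le> r" using v(1) by (simp add: V_def)
      finally show ?thesis .
    qed
    then have "h (act' g y0) \<le> (\<Sum>k<K. r)" unfolding h_def by (intro sum_mono) simp
    also have "\<dots> \<le> e / 2" using r(2) by simp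
    finally show "1 \<le> f (act' g y0)" using e(1) by (simp add: f_def field_simps)
  qed
  also have "\<dots> < ereal \<delta>" using fint by simp
  finally show False using spec[OF \<delta>(2), of V] V by simp
qed

lemma upper_BD_ge_common_image:
  assumes A: "A \<in> sets borel" "A \<subseteq> common_image K U" and U: "\<And>k. k < K \<Longrightarrow> open (U k)"
    and V: "open V" "V \<noteq> {}"
  shows "ereal (measure \<nu> A) \<le> upper_BD {g. \<forall>k<K. act g ` V \<inter> U k \<noteq> {}}"
proof -
  let ?S = "{g. \<forall>k<K. act g ` V \<inter> U k \<noteq> {}}"
  obtain F :: "nat \<Rightarrow> 'g set" where F: "folner F" using amenable by (auto simp: amenable_def)
  note fin = folner_finite[OF F]
  obtain z0 \<eta> where z0: "\<eta> > 0" "{y. rho z0 y < \<eta>} \<subseteq> \<pi> ` V"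
    using image_open_contains_rho_ball[OF V] by (elim exE conjE)
  have "\<exists>t. measure \<nu> A \<le> favg (F n) (\<lambda>f. indicator ?S (f + t))" for n
  proof -
    have meas: "(indicator A :: 'y \<Rightarrow> real) \<in> borel_measurable borel" using A(1) by simp
    have meas_s: "(\<lambda>y. indicator A (act' s y) :: real) \<in> borel_measurable borel" for s
      using measurable_compose[OF borel_measurable_continuous_onI[OF Y.continuous_act] meas] .
    have int_s: "integrable \<nu> (\<lambda>y. indicator A (act' s y) :: real)" for s
      by (rule integrable_bounded[OF meas_s, of _ 1]) (simp add: indicator_def)
    have int: "integrable \<nu> (\<lambda>y. favg (F n) (\<lambda>s. indicator A (act' s y)))"
      unfolding favg_def using int_s by auto
    have "(\<integral>y. favg (F n) (\<lambda>s. indicator A (act' s y)) \<partial>\<nu>) = favg (F n) (\<lambda>s. \<integral>y. indicator A (act' s y) \<partial>\<nu>)"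
      unfolding favg_def using int_s by simp
    also have "\<dots> = measure \<nu> A"
      using fin A(1) by (simp add: integral_act[OF meas] favg_const)
    finally have eq: "(\<integral>y. favg (F n) (\<lambda>s. indicator A (act' s y)) \<partial>\<nu>) = measure \<nu> A" .
    \<comment> \<open>Some point does at least as well as the integral, by which the frequency
      averages to the measure of \<open>A\<close>.\<close>
    have "\<exists>z. measure \<nu> A \<le> favg (F n) (\<lambda>s. indicator A (act' s z))"
    proof (rule ccontr)
      assume "\<not> ?thesis"
      then have "favg (F n) (\<lambda>s. indicator A (act' s z)) < measure \<nu> A" for z by (auto simp: not_le)
      then have "(\<integral>y. favg (F n) (\<lambda>s. indicator A (act' s y)) \<partial>\<nu>) < (\<integral>y. measure \<nu> A \<partial>\<nu>)"
        by (intro integral_less_AE_space int) (auto simp: emeasure_space_1 simp del: space_nu)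
      then show False using eq by (simp add: prob_space del: space_nu)
    qed
    then obtain z where z: "measure \<nu> A \<le> favg (F n) (\<lambda>s. indicator A (act' s z))" ..
    \<comment> \<open>The image of \<open>V\<close> contains a ball about \<open>z0\<close> only;
      \<open>s\<close> moves that ball over \<open>z\<close> at the cost of half its radius.\<close>
    obtain s where s: "rho z (act' s z0) < \<eta>/2"
      using orbit_rho_dense[of "\<eta>/2" z z0] z0(1) by auto
    have oV: "open (act s ` V)" by (rule open_image_act[OF V(1)])
    have ball: "{y. rho z y < \<eta>/2} \<subseteq> \<pi> ` act s ` V"
    proof
      fix y assume "y \<in> {y. rho z y < \<eta>/2}"
      then have "rho (act' s z0) y < \<eta>" using s rho_triangle[of "act' s z0" y z] by (simp add: rho_commute)
      then have "rho z0 (act' (- s) y) < \<eta>" using rho_act[of s z0 "act' (- s) y"] by simp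
      then have "act' (- s) y \<in> \<pi> ` V" by (intro subsetD[OF z0(2)]) simp
      then obtain v where v: "v \<in> V" "act' (- s) y = \<pi> v" by blast
      have "\<pi> (act s v) = act' s (act' (- s) y)" by (simp add: v(2) pi_act)
      then have "y = \<pi> (act s v)" by simp
      then show "y \<in> \<pi> ` act s ` V" using v(1) by blast
    qed
    define G where "G = {f \<in> F n. act' f z \<in> A}"
    define T where "T = (\<lambda>(f, k). (act s ` V, z, act f -` U k)) ` (G \<times> {..<K})"
    have finT: "finite T" using fin by (simp add: T_def G_def)
    have TP: "z' \<in> {z} \<and> open V' \<and> {y. rho z' y < \<eta>/2} \<subseteq> \<pi> ` V' \<and> open U' \<and> (\<exists>x\<in>U'. \<pi> x = z')"
      if inT: "(V', z', U') \<in> T" for V' z' U'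
    proof -
      obtain f k where fk: "f \<in> G" "k < K" "V' = act s ` V" "z' = z" "U' = act f -` U k"
        using inT by (auto simp: T_def)
      have "act' f z \<in> \<pi> ` U k" using fk(1,2) A(2) by (auto simp: G_def common_image_def)
      then obtain x where x: "x \<in> U k" "\<pi> x = act' f z" by auto
      have "act (- f) x \<in> U'" "\<pi> (act (- f) x) = z'" using x fk by (auto simp: pi_act)
      moreover have "open U'" unfolding fk(5) by (rule open_vimage_act[OF U[OF fk(2)]])
      moreover have "open V'" "{y. rho z' y < \<eta>/2} \<subseteq> \<pi> ` V'" unfolding fk(3,4) by (fact oV ball)+
      ultimately show ?thesis using fk(4) by (intro conjI bexI[of _ "act (- f) x"]) simp_all
    qed
    have "\<exists>t. (\<forall>b\<in>{z}. rho (act' t b) b < 1) \<and> (\<forall>(V, z, U)\<in>T. act t ` V \<inter> U \<noteq> {})"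
    proof (rule simultaneous_hitting[where \<eta> = "\<eta>/2", OF finT])
      fix V' z' U' assume "(V', z', U') \<in> T"
      then show "z' \<in> {z} \<and> open V' \<and> {y. rho z' y < \<eta>/2} \<subseteq> \<pi> ` V' \<and> open U' \<and> (\<exists>x\<in>U'. \<pi> x = z')"
        by (rule TP)
    qed (use z0(1) in simp_all)
    then obtain t where t: "\<forall>(V, z, U)\<in>T. act t ` V \<inter> U \<noteq> {}" by (elim exE conjE)
    have "f + (t + s) \<in> ?S" if "f \<in> G" for f
    proof (rule CollectI, intro allI impI)
      fix k assume "k < K"
      then have "(f, k) \<in> G \<times> {..<K}" using that by simp
      then have inT: "(act s ` V, z, act f -` U k) \<in> T" unfolding T_def by (rule rev_image_eqI) simp
      have "act t ` act s ` V \<inter> act f -` U k \<noteq> {}" using bspec[OF t inT] by simp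
      then obtain v where "v \<in> V" "act f (act t (act s v)) \<in> U k" by blast
      then have "act (f + (t + s)) v \<in> act (f + (t + s)) ` V \<inter> U k" by (simp add: act_add)
      then show "act (f + (t + s)) ` V \<inter> U k \<noteq> {}" by blast
    qed
    then have "favg (F n) (\<lambda>f. indicator A (act' f z)) \<le> favg (F n) (\<lambda>f. indicator ?S (f + (t + s)))"
      by (intro favg_mono) (auto simp: indicator_def G_def)
    then show ?thesis using z by (intro exI[of _ "t + s"]) linarith
  qed
  then have "\<forall>n. \<exists>t. measure \<nu> A \<le> favg (F n) (\<lambda>f. indicator ?S (f + t))" by (rule allI)
  from choice[OF this] obtain t where t: "\<forall>n. measure \<nu> A \<le> favg (F n) (\<lambda>f. indicator ?S (f + t n))"
    by (elim exE)
  define F' where "F' n = (\<lambda>g. g + t n) ` F n" for n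
  have F': "folner F'" unfolding F'_def by (rule folner_translate_right[OF F])
  have "measure \<nu> A \<le> real (card (F' n \<inter> ?S)) / real (card (F' n))" for n
  proof -
    have "favg (F' n) (indicator ?S) = favg (F n) (\<lambda>f. indicator ?S (f + t n))"
      unfolding F'_def by (rule favg_image) (simp add: inj_on_def)
    then show ?thesis
      using spec[OF t, of n] favg_indicator[OF folner_finite(1)[OF F'], of n ?S] by simp
  qed
  then have "ereal (measure \<nu> A) \<le> limsup (\<lambda>n. ereal (real (card (F' n \<inter> ?S)) / real (card (F' n))))"
    by (intro le_Limsup always_eventually) auto
  also have "\<dots> \<le> upper_BD ?S"
    unfolding upper_BD_def by (rule SUP_upper) (simp add: F')
  finally show ?thesis .
qed

end

section \<open>Weakly mean-sensitive fibres\<close>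

lemma favg_sum: "favg F (\<lambda>g. \<Sum>s\<in>S. \<phi> s g) = (\<Sum>s\<in>S. favg F (\<phi> s))"
  by (simp add: favg_def sum.swap[of _ F S] sum_divide_distrib)

text \<open>\<open>N\<close> distinct translates of a point indicator add up to at most 1, while
  their averages are asymptotically equal, so each is asymptotically at most
  \<open>1/N\<close>.\<close>

lemma folner_singleton_null:
  fixes F :: "nat \<Rightarrow> 'g::group_add set"
  assumes inf: "infinite (UNIV :: 'g set)" and F: "folner F"
  shows "(\<lambda>n. favg (F n) (indicator {p})) \<longlonglongrightarrow> 0"
proof (rule tendstoI)
  fix e :: real assume e: "e > 0"
  obtain N :: nat where N: "N > 0" "inverse (real N) < e/2"
    using ex_inverse_of_nat_less[of "e/2"] e by auto
  obtain H :: "'g set" where H: "finite H" "card H = N"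
    using infinite_arbitrarily_large[OF inf] by blast
  have b: "\<bar>indicator {p} g :: real\<bar> \<le> 1" for g by (simp add: indicator_def)
  have "eventually (\<lambda>n. \<forall>h\<in>H. \<bar>favg (F n) (\<lambda>g. indicator {p} (h + g)) - favg (F n) (indicator {p})\<bar> < e/2) sequentially"
  proof (rule eventually_ball_finite[OF H(1)], rule ballI)
    fix h
    show "eventually (\<lambda>n. \<bar>favg (F n) (\<lambda>g. indicator {p} (h + g)) - favg (F n) (indicator {p})\<bar> < e/2) sequentially"
      using tendstoD[OF folner_favg_translate[where h = h and \<phi> = "indicator {p}", OF F b] half_gt_zero[OF e]]
      by (simp add: dist_real_def)
  qed
  then show "eventually (\<lambda>n. dist (favg (F n) (indicator {p})) 0 < e) sequentially"
  proof (rule eventually_mono)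
    fix n
    assume n: "\<forall>h\<in>H. \<bar>favg (F n) (\<lambda>g. indicator {p} (h + g)) - favg (F n) (indicator {p})\<bar> < e/2"
    let ?a = "favg (F n) (indicator {p})"
    have one: "(\<Sum>h\<in>H. indicator {p} (h + g) :: real) \<le> 1" for g
    proof -
      have "(\<Sum>h\<in>H. indicator {p} (h + g) :: real) = (\<Sum>h\<in>H. if h = p - g then 1 else 0)"
        by (rule sum.cong) (auto simp: indicator_def eq_diff_eq)
      then show ?thesis using H(1) by simp
    qed
    have "(\<Sum>h\<in>H. ?a - e/2) \<le> (\<Sum>h\<in>H. favg (F n) (\<lambda>g. indicator {p} (h + g)))"
    proof (rule sum_mono)
      fix h assume "h \<in> H"
      then show "?a - e/2 \<le> favg (F n) (\<lambda>g. indicator {p} (h + g))" using n[rule_format, of h] by linarith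
    qed
    also have "\<dots> = favg (F n) (\<lambda>g. \<Sum>h\<in>H. indicator {p} (h + g))" by (rule favg_sum[symmetric])
    also have "\<dots> \<le> favg (F n) (\<lambda>_. 1)" using one by (intro favg_mono)
    also have "\<dots> = 1" using folner_finite[OF F, of n] by (simp add: favg_const)
    finally have "real N * (?a - e/2) \<le> 1" using H(2) by simp
    then have "?a - e/2 \<le> inverse (real N)" using N(1) by (simp add: field_simps)
    then have "?a < e" using N(2) by linarith
    moreover have "0 \<le> ?a" by (auto simp: favg_def intro!: divide_nonneg_nonneg sum_nonneg)
    ultimately show "dist ?a 0 < e" by simp
  qed
qed

lemma folner_finite_null:
  fixes F :: "nat \<Rightarrow> 'g::group_add set"
  assumes "infinite (UNIV :: 'g set)" "folner F" "finite S"
  shows "(\<lambda>n. favg (F n) (indicator S)) \<longlonglongrightarrow> 0"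
proof -
  have "indicator S = (\<lambda>g. \<Sum>p\<in>S. indicator {p} g :: real)"
    using assms(3) by (simp add: indicator_def fun_eq_iff)
  then have "favg (F n) (indicator S) = (\<Sum>p\<in>S. favg (F n) (indicator {p}))" for n
    by (simp only: favg_sum)
  moreover have "(\<lambda>n. \<Sum>p\<in>S. favg (F n) (indicator {p})) \<longlonglongrightarrow> (\<Sum>p\<in>S. 0)"
    by (intro tendsto_sum folner_singleton_null assms)
  ultimately show ?thesis by simp
qed

lemma finite_common_radius:
  assumes "finite S" "\<And>s. s \<in> S \<Longrightarrow> \<exists>r>0::real. P s r"
    and mono: "\<And>s r r'. P s r \<Longrightarrow> 0 < r' \<Longrightarrow> r' \<le> r \<Longrightarrow> P s r'"
  shows "\<exists>r>0. \<forall>s\<in>S. P s r"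
  using assms(1,2)
proof (induction S)
  case empty
  then show ?case by (intro exI[of _ 1]) simp
next
  case (insert s S)
  then obtain r where r: "r > 0" "\<forall>s\<in>S. P s r" by auto
  obtain r' where r': "r' > 0" "P s r'" using insert.prems[of s] by auto
  have "P s (min r r')" by (rule mono[OF r'(2)]) (use r(1) r'(1) in auto)
  moreover have "P s' (min r r')" if "s' \<in> S" for s'
    using bspec[OF r(2) that] by (rule mono) (use r(1) r'(1) in auto)
  ultimately show ?case using r(1) r'(1) by (intro exI[of _ "min r r'"]) auto
qed

context mef_measure
begin

text \<open>The null sets among the common images of finite lists of basic closed balls are
  countably many, and \<open>Z\<close> is the complement of their union. A tuple in the fibre over a
  point of \<open>Z\<close> fits into such balls inside the given \<open>U k\<close>, and their
  common image contains that point, so it has positive measure. \<open>Z\<close> is dense since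
  nonempty open sets have positive measure.\<close>

lemma wms_fibres:
  "\<exists>Z. gdelta_in euclidean Z \<and> closure Z = UNIV \<and> Z \<in> sets \<nu> \<and> emeasure \<nu> Z = 1 \<and>
       (\<forall>y\<in>Z. wms_set act (\<pi> -` {y}))"
proof -
  obtain s :: "nat \<Rightarrow> 'x" where s: "\<forall>x. \<forall>e>0. \<exists>n. dist x (s n) < e"
    using compact_dense_sequence[OF compact_X] by (elim exE)
  \<comment> \<open>Closed balls make the common images closed, and hence \<open>Z\<close> a
    countable intersection of open sets.\<close>
  define C where "C p = cball (s (fst p)) (inverse (real (Suc (snd p))))" for p :: "nat \<times> nat"
  define A where "A l = common_image (length l) (\<lambda>k. C (l ! k))" for l :: "(nat \<times> nat) list"
  have closedA: "closed (A l)" for l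
    unfolding A_def by (rule closed_common_image) (simp add: C_def)
  define N where "N = {l. measure \<nu> (A l) = 0}"
  \<comment> \<open>\<open>UNIV\<close> keeps the family nonempty when there are no null sets in the
    list.\<close>
  define Z where "Z = \<Inter>(insert UNIV ((\<lambda>l. - A l) ` N))"
  have "gdelta_in euclidean Z"
    unfolding Z_def
  proof (rule gdelta_in_Inter)
    show "countable (insert UNIV ((\<lambda>l. - A l) ` N))" by simp
    fix S assume "S \<in> insert UNIV ((\<lambda>l. - A l) ` N)"
    then have "open S" using closedA by (auto simp: open_Compl)
    then show "gdelta_in euclidean S" by (intro open_imp_gdelta_in) simp
  qed simp
  moreover have null: "(\<Union>l\<in>N. A l) \<in> null_sets \<nu>"
  proof (rule null_sets_UN')
    fix l assume "l \<in> N"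
    then show "A l \<in> null_sets \<nu>"
      using closedA by (intro null_setsI) (auto simp: N_def emeasure_eq_measure)
  qed simp
  have Z: "Z = UNIV - (\<Union>l\<in>N. A l)" by (auto simp: Z_def)
  moreover have setsZ: "Z \<in> sets \<nu>"
    unfolding Z using null_setsD2[OF null] by (metis sets.compl_sets space_nu)
  moreover have mZ: "emeasure \<nu> Z = 1"
    using emeasure_Diff_null_set[OF null, of UNIV] emeasure_space_1 unfolding Z by simp
  moreover have "closure Z = UNIV"
  proof (rule ccontr)
    assume "closure Z \<noteq> UNIV"
    then have "0 < measure \<nu> (- closure Z)" by (intro open_pos) auto
    moreover have "- closure Z \<subseteq> (\<Union>l\<in>N. A l)" using closure_subset[of Z] unfolding Z by blast
    then have "emeasure \<nu> (- closure Z) \<le> emeasure \<nu> (\<Union>l\<in>N. A l)"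
      using null_setsD2[OF null] by (rule emeasure_mono)
    then have "measure \<nu> (- closure Z) = 0" using null_setsD1[OF null] by (simp add: measure_def)
    ultimately show False by simp
  qed
  moreover have "wms_set act (\<pi> -` {y})" if y: "y \<in> Z" for y
    unfolding wms_set_def wms_tuple_def
  proof (intro allI impI)
    fix K xs and U :: "nat \<Rightarrow> 'x set"
    assume xs: "\<forall>k<K. xs k \<in> \<pi> -` {y}" and U: "\<forall>k<K. open (U k) \<and> xs k \<in> U k"
    have "\<exists>p. xs k \<in> C p \<and> C p \<subseteq> U k" if "k < K" for k
    proof -
      have "open (U k)" "xs k \<in> U k" using U that by auto
      then obtain r where r: "r > 0" "ball (xs k) r \<subseteq> U k" by (metis open_contains_ball)
      obtain m where m: "inverse (real (Suc m)) < r/2" using reals_Archimedean[of "r/2"] r(1) by auto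
      obtain n where n: "dist (xs k) (s n) < inverse (real (Suc m))"
        using s by (metis inverse_positive_iff_positive of_nat_0_less_iff zero_less_Suc)
      have "xs k \<in> C (n, m)" using n by (simp add: C_def dist_commute)
      moreover have "C (n, m) \<subseteq> ball (xs k) r"
      proof
        fix x assume "x \<in> C (n, m)"
        then have "dist (s n) x \<le> inverse (real (Suc m))" by (simp add: C_def)
        then show "x \<in> ball (xs k) r"
          using n m dist_triangle[of "xs k" x "s n"] unfolding mem_ball by linarith
      qed
      ultimately show ?thesis using r(2) by blast
    qed
    then have "\<forall>k. \<exists>p. k < K \<longrightarrow> xs k \<in> C p \<and> C p \<subseteq> U k" by blast
    from choice[OF this] obtain p where p: "\<forall>k. k < K \<longrightarrow> xs k \<in> C (p k) \<and> C (p k) \<subseteq> U k" by (elim exE)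
    let ?l = "map p [0..<K]"
    have Aeq: "A ?l = common_image K (\<lambda>k. C (p k))" by (auto simp: A_def common_image_def)
    have "y \<in> A ?l" unfolding Aeq common_image_def using xs p by (auto intro!: image_eqI)
    then have "?l \<notin> N" using y by (auto simp: Z)
    then have pos: "measure \<nu> (A ?l) > 0" using measure_nonneg[of \<nu> "A ?l"] by (simp add: N_def less_le)
    have sub: "A ?l \<subseteq> common_image K U" unfolding Aeq common_image_def using p by blast
    have "ereal (measure \<nu> (A ?l)) \<le> upper_BD {g. \<forall>k<K. act g ` V \<inter> U k \<noteq> {}}"
      if "open V \<and> V \<noteq> {}" for V
      using U that closedA by (intro upper_BD_ge_common_image[OF _ sub]) auto
    moreover have "ereal (measure \<nu> (A ?l) / 2) < ereal (measure \<nu> (A ?l))" using pos by simp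
    ultimately have "\<forall>V. open V \<and> V \<noteq> {} \<longrightarrow>
        upper_BD {g. \<forall>k<K. act g ` V \<inter> U k \<noteq> {}} > ereal (measure \<nu> (A ?l) / 2)"
      using less_le_trans by blast
    then show "\<exists>\<delta>>0. \<forall>V. open V \<and> V \<noteq> {} \<longrightarrow>
        upper_BD {g. \<forall>k<K. act g ` V \<inter> U k \<noteq> {}} > ereal \<delta>"
      using pos by (intro exI[of _ "measure \<nu> (A ?l) / 2"]) simp
  qed
  ultimately show ?thesis by blast
qed

lemma measure_one_Int_nonempty:
  assumes "A \<in> sets \<nu>" "emeasure \<nu> A = 1" "B \<in> sets \<nu>" "0 < measure \<nu> B"
  shows "A \<inter> B \<noteq> {}"
proof
  assume "A \<inter> B = {}"
  then have "measure \<nu> (A \<union> B) = measure \<nu> A + measure \<nu> B"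
    using assms by (intro finite_measure_Union) auto
  moreover have "measure \<nu> A = 1" using assms(2) by (simp add: measure_def)
  moreover have "measure \<nu> (A \<union> B) \<le> 1" by simp
  ultimately show False using assms(4) by simp
qed

text \<open>For existence, enumerate a fibre with \<open>K\<close> points over the set of full
  measure just found. For the bound, \<open>K + 1\<close> distinct entries have disjoint closed
  balls whose common image has positive measure, so some fibre with only \<open>K\<close> points
  would meet all \<open>K + 1\<close> balls.\<close>

lemma essential_wms_tuples:
  assumes reg: "regular_K_to_one \<pi> \<nu> K"
  shows "\<exists>xs. essential K xs \<and> wms_tuple act K xs"
    and "\<not> (\<exists>xs. essential (K + 1) xs \<and> wms_tuple act (K + 1) xs)"
proof -
  let ?R = "{y. finite (\<pi> -` {y}) \<and> card (\<pi> -` {y}) = K}"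
  have R: "?R \<in> sets \<nu>" "emeasure \<nu> ?R = 1" using reg by (auto simp: regular_K_to_one_def)
  obtain Z where Z: "Z \<in> sets \<nu>" "emeasure \<nu> Z = 1" "\<forall>y\<in>Z. wms_set act (\<pi> -` {y})"
    using wms_fibres by (elim exE conjE)
  have "?R \<inter> Z \<noteq> {}"
    using Z(2) by (intro measure_one_Int_nonempty R Z(1)) (simp add: measure_def)
  then obtain y where y: "finite (\<pi> -` {y})" "card (\<pi> -` {y}) = K" "y \<in> Z" by auto
  obtain xs where xs: "bij_betw xs {0..<K} (\<pi> -` {y})"
    using ex_bij_betw_nat_finite[OF y(1)] y(2) by auto
  have "essential K xs" using xs by (simp add: essential_def bij_betw_def lessThan_atLeast0)
  moreover have "\<forall>k<K. xs k \<in> \<pi> -` {y}" using xs by (auto simp: bij_betw_def)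
  then have "wms_tuple act K xs" using bspec[OF Z(3) y(3)] unfolding wms_set_def by blast
  ultimately show "\<exists>xs. essential K xs \<and> wms_tuple act K xs" by blast
  show "\<not> (\<exists>xs. essential (K + 1) xs \<and> wms_tuple act (K + 1) xs)"
  proof
    assume "\<exists>xs. essential (K + 1) xs \<and> wms_tuple act (K + 1) xs"
    then obtain xs where ess: "inj_on xs {..<K + 1}" and wms: "wms_tuple act (K + 1) xs"
      by (auto simp: essential_def)
    have "\<exists>r>0. \<forall>q\<in>{(i, j). i < K + 1 \<and> j < K + 1 \<and> i \<noteq> j}. 2 * r < dist (xs (fst q)) (xs (snd q))"
    proof (rule finite_common_radius)
      show "finite {(i, j). i < K + 1 \<and> j < K + 1 \<and> i \<noteq> j}"
        by (rule finite_subset[of _ "{..<K+1} \<times> {..<K+1}"]) auto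
      fix q assume "q \<in> {(i, j). i < K + 1 \<and> j < K + 1 \<and> i \<noteq> j}"
      then have "0 < dist (xs (fst q)) (xs (snd q))" using inj_onD[OF ess] by auto
      then show "\<exists>r>0. 2 * r < dist (xs (fst q)) (xs (snd q))"
        by (intro exI[of _ "dist (xs (fst q)) (xs (snd q)) / 3"]) simp
    qed auto
    then obtain r where r: "r > 0" "\<And>i j. i < K + 1 \<Longrightarrow> j < K + 1 \<Longrightarrow> i \<noteq> j \<Longrightarrow> 2 * r < dist (xs i) (xs j)"
      by auto
    let ?A = "common_image (K + 1) (\<lambda>k. closure (ball (xs k) r))"
    have "0 < measure \<nu> ?A"
      using r(1) by (intro wms_tuple_common_image_pos[OF wms]) auto
    moreover have "?A \<in> sets \<nu>" using closed_common_image[of "K + 1" "\<lambda>k. closure (ball (xs k) r)"] by simp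
    ultimately have "?R \<inter> ?A \<noteq> {}" by (intro measure_one_Int_nonempty R)
    then obtain y where y: "finite (\<pi> -` {y})" "card (\<pi> -` {y}) = K" "y \<in> ?A" by auto
    have "\<forall>k. \<exists>x. k < K + 1 \<longrightarrow> x \<in> closure (ball (xs k) r) \<and> \<pi> x = y"
      using y(3) by (auto simp: common_image_def)
    from choice[OF this] obtain a where
      a: "\<forall>k. k < K + 1 \<longrightarrow> a k \<in> closure (ball (xs k) r) \<and> \<pi> (a k) = y" by (elim exE)
    have near: "dist (xs k) (a k) \<le> r" if "k < K + 1" for k
      using a that closure_mono[OF ball_subset_cball, of "xs k" r] by (auto simp: closure_closed subset_iff)
    have "inj_on a {..<K + 1}"
    proof (rule inj_onI, rule ccontr)
      fix i j assume ij: "i \<in> {..<K + 1}" "j \<in> {..<K + 1}" "a i = a j" "i \<noteq> j"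
      then have "dist (xs i) (xs j) \<le> 2 * r"
        using near[of i] near[of j] dist_triangle[of "xs i" "xs j" "a i"] dist_commute[of "xs j" "a j"] by simp
      then show False using r(2)[of i j] ij by auto
    qed
    then have "card (a ` {..<K + 1}) = K + 1" by (simp add: card_image)
    moreover have "card (a ` {..<K + 1}) \<le> card (\<pi> -` {y})"
      using a y(1) by (intro card_mono) auto
    ultimately show False using y(2) by simp
  qed
qed

end

section \<open>Independence sets\<close>

context mef_measure
begin

text \<open>The open sets \<open>V \<sigma>\<close> witness independence of \<open>J\<close>. The sets \<open>\<pi> ` V \<sigma>\<close> may be disjoint, so what makes
  an extension of \<open>J\<close> possible is that, up to any error, a positive proportion of the group moves
  all the base points \<open>z \<sigma>\<close> close to \<open>A\<close> at once.\<close>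
definition indep_state ::
    "(nat \<Rightarrow> 'g set) \<Rightarrow> 'y set \<Rightarrow> nat \<Rightarrow> (nat \<Rightarrow> 'x set) \<Rightarrow> 'g set \<Rightarrow> bool" where
  "indep_state F A K U J \<longleftrightarrow> (\<exists>V z \<alpha>. \<alpha> > 0 \<and>
     (\<forall>\<sigma>\<in>PiE J (\<lambda>_. {..<K}). open (V \<sigma>) \<and> (\<exists>\<eta>>0. {y. rho (z \<sigma>) y < \<eta>} \<subseteq> \<pi> ` V \<sigma>) \<and>
        (\<forall>g\<in>J. V \<sigma> \<subseteq> act g -` U (\<sigma> g))) \<and>
     (\<forall>\<epsilon>>0. eventually (\<lambda>n. \<alpha> \<le> favg (F n)
        (indicator {g. \<forall>\<sigma>\<in>PiE J (\<lambda>_. {..<K}). infdist (act' g (z \<sigma>)) A < \<epsilon>})) sequentially))"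

lemma infdist_rho_le: "infdist a A \<le> infdist b A + rho a b"
  using infdist_triangle[of a A b] dist_le_rho[of a b] by linarith

text \<open>Equidistribution of a tent function between the indicators of \<open>A\<close> and of
  its \<open>\<epsilon>\<close>-neighbourhood gives the lower bound, half of the measure of
  \<open>A\<close>, for every \<open>\<epsilon>\<close>.\<close>

lemma indep_state_empty:
  assumes F: "folner F" and A: "closed A" "0 < measure \<nu> A"
  shows "indep_state F A K U {}"
proof -
  fix z :: 'y
  have "eventually (\<lambda>n. measure \<nu> A / 2 \<le> favg (F n) (indicator {g. infdist (act' g z) A < \<epsilon>})) sequentially"
    if \<epsilon>: "\<epsilon> > 0" for \<epsilon>
  proof -
    define f where "f y = max 0 (1 - infdist y A / \<epsilon>)" for y
    have f: "continuous_on UNIV f" unfolding f_def using \<epsilon> by (intro continuous_intros) auto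
    have "measure \<nu> A = (\<integral>y. indicator A y \<partial>\<nu>)" using A(1) by simp
    also have "\<dots> \<le> (\<integral>y. f y \<partial>\<nu>)"
    proof (rule integral_mono)
      show "integrable \<nu> (indicator A :: 'y \<Rightarrow> real)"
        using A(1) by (intro integrable_real_indicator) (auto simp: emeasure_eq_measure)
      show "integrable \<nu> f"
        using \<epsilon> by (intro integrable_bounded[OF measurable_continuous[OF f], of 1]) (simp add: f_def infdist_nonneg)
      show "indicator A y \<le> f y" for y by (auto simp: f_def indicator_def)
    qed
    finally have "measure \<nu> A / 2 < (\<integral>y. f y \<partial>\<nu>)" using A(2) by linarith
    with folner_equidistribution[OF f F, of z]
    have "eventually (\<lambda>n. measure \<nu> A / 2 < favg (F n) (\<lambda>g. f (act' g z))) sequentially"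
      by (rule order_tendstoD)
    then show ?thesis
    proof (rule eventually_mono)
      fix n assume "measure \<nu> A / 2 < favg (F n) (\<lambda>g. f (act' g z))"
      also have "\<dots> \<le> favg (F n) (indicator {g. infdist (act' g z) A < \<epsilon>})"
        using \<epsilon> by (intro favg_mono) (auto simp: f_def indicator_def infdist_nonneg)
      finally show "measure \<nu> A / 2 \<le> favg (F n) (indicator {g. infdist (act' g z) A < \<epsilon>})" by simp
    qed
  qed
  moreover have "\<exists>\<eta>>0. {y. rho z y < \<eta>} \<subseteq> range \<pi>" using surj_pi by (intro exI[of _ 1]) simp
  ultimately show ?thesis
    unfolding indep_state_def using A(2)
    by (intro exI[of _ "\<lambda>_. UNIV"] exI[of _ "\<lambda>_. z"] exI[of _ "measure \<nu> A / 2"]) simp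
qed

text \<open>The elements of \<open>S\<close> bring all base points \<open>e/2\<close>-close to
  \<open>A\<close>. Those that fail the finer distance \<open>\<epsilon>\<close> are counted by the
  averages of \<open>f1 - f2\<close>, whose integral is at most the measure of the
  \<open>e\<close>-neighbourhood outside \<open>A\<close>. Summed over all patterns the loss is
  below \<open>\<alpha>/2\<close>, whatever \<open>\<epsilon>\<close> is.\<close>

lemma density_refine:
  assumes F: "folner F" and A: "closed A" "A \<noteq> {}" and fin: "finite \<Sigma>"
    and e: "e > 0" "real (card \<Sigma>) * (measure \<nu> {y. infdist y A \<le> e} - measure \<nu> A) \<le> \<alpha> / 4" and \<alpha>: "\<alpha> > 0"
    and dens: "eventually (\<lambda>n. \<alpha> \<le> favg (F n) (indicator S)) sequentially"
    and near: "\<And>g \<sigma>. g \<in> S \<Longrightarrow> \<sigma> \<in> \<Sigma> \<Longrightarrow> infdist (act' g (z \<sigma>)) A < e / 2" and \<epsilon>: "\<epsilon> > 0"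
  shows "eventually (\<lambda>n. \<alpha> / 2 \<le> favg (F n) (indicator {g. \<forall>\<sigma>\<in>\<Sigma>. infdist (act' g (z \<sigma>)) A < \<epsilon>})) sequentially"
proof -
  \<comment> \<open>The bound \<open>e/2\<close> makes \<open>f2\<close> vanish wherever
    \<open>f1\<close> is below 1, so that \<open>f1 - f2\<close> is nonnegative.\<close>
  define \<epsilon>' where "\<epsilon>' = min \<epsilon> (e / 2)"
  have \<epsilon>': "\<epsilon>' > 0" "\<epsilon>' \<le> \<epsilon>" "\<epsilon>' \<le> e / 2" using \<epsilon> e(1) by (auto simp: \<epsilon>'_def)
  define f1 where "f1 y = max 0 (min 1 (2 - 2 * infdist y A / e))" for y
  define f2 where "f2 y = max 0 (1 - infdist y A / \<epsilon>')" for y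
  have f1: "continuous_on UNIV f1" unfolding f1_def using e(1) by (intro continuous_intros) auto
  have f2: "continuous_on UNIV f2" unfolding f2_def using \<epsilon>'(1) by (intro continuous_intros) auto
  have f: "continuous_on UNIV (\<lambda>y. f1 y - f2 y)" by (intro continuous_intros f1 f2)
  have int1: "integrable \<nu> f1"
    by (rule integrable_bounded[OF measurable_continuous[OF f1], of 1]) (simp add: f1_def)
  have int2: "integrable \<nu> f2"
    using \<epsilon>'(1) by (intro integrable_bounded[OF measurable_continuous[OF f2], of 1]) (simp add: f2_def infdist_nonneg)
  have setE: "{y. infdist y A \<le> e} \<in> sets \<nu>"
    by (auto intro!: borel_closed closed_Collect_le continuous_intros)
  have "(\<integral>y. f1 y \<partial>\<nu>) \<le> (\<integral>y. indicator {y. infdist y A \<le> e} y \<partial>\<nu>)"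
  proof (rule integral_mono[OF int1])
    show "integrable \<nu> (indicator {y. infdist y A \<le> e} :: 'y \<Rightarrow> real)"
      using setE by (intro integrable_real_indicator) (auto simp: emeasure_eq_measure)
    show "f1 y \<le> indicator {y. infdist y A \<le> e} y" for y
      using e(1) by (auto simp: f1_def indicator_def field_simps)
  qed
  moreover have "(\<integral>y. indicator A y \<partial>\<nu>) \<le> (\<integral>y. f2 y \<partial>\<nu>)"
  proof (rule integral_mono[OF _ int2])
    show "integrable \<nu> (indicator A :: 'y \<Rightarrow> real)"
      using A(1) by (intro integrable_real_indicator) (auto simp: emeasure_eq_measure)
    show "indicator A y \<le> f2 y" for y by (auto simp: f2_def indicator_def)
  qed
  ultimately have le: "(\<integral>y. f1 y - f2 y \<partial>\<nu>) \<le> measure \<nu> {y. infdist y A \<le> e} - measure \<nu> A"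
    using A(1) setE by (simp add: int1 int2)
  have "(\<lambda>n. \<Sum>\<sigma>\<in>\<Sigma>. favg (F n) (\<lambda>g. f1 (act' g (z \<sigma>)) - f2 (act' g (z \<sigma>))))
      \<longlonglongrightarrow> (\<Sum>\<sigma>\<in>\<Sigma>. \<integral>y. f1 y - f2 y \<partial>\<nu>)"
    by (intro tendsto_sum folner_equidistribution[OF f F])
  moreover have "(\<Sum>\<sigma>\<in>\<Sigma>. \<integral>y. f1 y - f2 y \<partial>\<nu>) < \<alpha> / 2"
    using mult_left_mono[OF le, of "real (card \<Sigma>)"] e(2) \<alpha> by simp
  ultimately have "eventually (\<lambda>n. (\<Sum>\<sigma>\<in>\<Sigma>. favg (F n) (\<lambda>g. f1 (act' g (z \<sigma>)) - f2 (act' g (z \<sigma>)))) < \<alpha> / 2) sequentially"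
    by (rule order_tendstoD)
  with dens show ?thesis
  proof eventually_elim
    case (elim n)
    let ?S = "{g. \<forall>\<sigma>\<in>\<Sigma>. infdist (act' g (z \<sigma>)) A < \<epsilon>}"
    have nn: "0 \<le> f1 y - f2 y" for y
    proof (cases "infdist y A < e / 2")
      case True
      then have "f1 y = 1" using e(1) by (simp add: f1_def field_simps)
      moreover have "f2 y \<le> 1" using \<epsilon>'(1) by (simp add: f2_def infdist_nonneg)
      ultimately show ?thesis by simp
    next
      case False
      then have "f2 y = 0" using \<epsilon>' by (simp add: f2_def field_simps)
      then show ?thesis by (simp add: f1_def)
    qed
    have "indicator S g \<le> indicator ?S g + (\<Sum>\<sigma>\<in>\<Sigma>. f1 (act' g (z \<sigma>)) - f2 (act' g (z \<sigma>)))" for g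
    proof (cases "g \<in> S \<and> g \<notin> ?S")
      case True
      then obtain \<sigma> where \<sigma>: "\<sigma> \<in> \<Sigma>" "\<epsilon> \<le> infdist (act' g (z \<sigma>)) A" by (auto simp: not_less)
      have "f1 (act' g (z \<sigma>)) = 1"
        using near[of g \<sigma>] True \<sigma>(1) e(1) by (simp add: f1_def field_simps)
      moreover have "f2 (act' g (z \<sigma>)) = 0" using \<sigma>(2) \<epsilon>' by (simp add: f2_def field_simps)
      moreover have "f1 (act' g (z \<sigma>)) - f2 (act' g (z \<sigma>)) \<le> (\<Sum>\<sigma>\<in>\<Sigma>. f1 (act' g (z \<sigma>)) - f2 (act' g (z \<sigma>)))"
        using \<sigma>(1) fin nn by (intro member_le_sum) auto
      ultimately have "1 \<le> (\<Sum>\<sigma>\<in>\<Sigma>. f1 (act' g (z \<sigma>)) - f2 (act' g (z \<sigma>)))" by linarith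
      then show ?thesis using True by (simp add: indicator_def)
    next
      case False
      have "0 \<le> (\<Sum>\<sigma>\<in>\<Sigma>. f1 (act' g (z \<sigma>)) - f2 (act' g (z \<sigma>)))" using nn by (intro sum_nonneg) auto
      moreover have "indicator S g \<le> (indicator ?S g :: real)" using False by (auto simp: indicator_def)
      ultimately show ?thesis by linarith
    qed
    then have "favg (F n) (indicator S) \<le> favg (F n) (\<lambda>g. indicator ?S g + (\<Sum>\<sigma>\<in>\<Sigma>. f1 (act' g (z \<sigma>)) - f2 (act' g (z \<sigma>))))"
      by (intro favg_mono)
    also have "\<dots> = favg (F n) (indicator ?S) + (\<Sum>\<sigma>\<in>\<Sigma>. favg (F n) (\<lambda>g. f1 (act' g (z \<sigma>)) - f2 (act' g (z \<sigma>))))"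
      by (simp add: favg_add favg_sum)
    finally show "\<alpha> / 2 \<le> favg (F n) (indicator ?S)" using elim by linarith
  qed
qed

lemma indep_state_step:
  assumes F: "folner F" and A: "closed A" "A \<noteq> {}" "A \<subseteq> common_image K U"
    and U: "\<And>k. k < K \<Longrightarrow> open (U k)" and J: "finite J" and state: "indep_state F A K U J"
  shows "\<exists>g. g \<notin> J \<and> indep_state F A K U (insert g J)"
proof -
  let ?\<Sigma> = "\<lambda>J :: 'g set. PiE J (\<lambda>_. {..<K})"
  obtain V z \<alpha> where \<alpha>: "\<alpha> > 0"
    and V: "\<forall>\<sigma>\<in>?\<Sigma> J. open (V \<sigma>) \<and> (\<exists>\<eta>>0. {y. rho (z \<sigma>) y < \<eta>} \<subseteq> \<pi> ` V \<sigma>) \<and>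
        (\<forall>g\<in>J. V \<sigma> \<subseteq> act g -` U (\<sigma> g))"
    and dens: "\<forall>\<epsilon>>0. eventually (\<lambda>n. \<alpha> \<le> favg (F n)
        (indicator {g. \<forall>\<sigma>\<in>?\<Sigma> J. infdist (act' g (z \<sigma>)) A < \<epsilon>})) sequentially"
    using state unfolding indep_state_def by (elim exE conjE)
  have fin\<Sigma>: "finite (?\<Sigma> J')" if "finite J'" for J' using that by (intro finite_PiE) auto
  have "\<exists>\<eta>>0. \<forall>\<sigma>\<in>?\<Sigma> J. {y. rho (z \<sigma>) y < \<eta>} \<subseteq> \<pi> ` V \<sigma>"
  proof (rule finite_common_radius[OF fin\<Sigma>[OF J]])
    fix \<sigma> assume "\<sigma> \<in> ?\<Sigma> J"
    then show "\<exists>\<eta>>0. {y. rho (z \<sigma>) y < \<eta>} \<subseteq> \<pi> ` V \<sigma>" using bspec[OF V] by simp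
  next
    fix \<sigma> and r r' :: real assume "{y. rho (z \<sigma>) y < r} \<subseteq> \<pi> ` V \<sigma>" "r' \<le> r"
    then show "{y. rho (z \<sigma>) y < r'} \<subseteq> \<pi> ` V \<sigma>" by force
  qed
  then obtain \<eta> where \<eta>: "\<eta> > 0" "\<forall>\<sigma>\<in>?\<Sigma> J. {y. rho (z \<sigma>) y < \<eta>} \<subseteq> \<pi> ` V \<sigma>" by (elim exE conjE)
  \<comment> \<open>A bound for the number of patterns on the enlarged set; the added 1 keeps it
    positive for \<open>K = 0\<close>.\<close>
  define m where "m = real (K ^ Suc (card J)) + 1"
  have m: "m > 0" by (simp add: m_def add_nonneg_pos)
  have A0: "{y. infdist y A = 0} = A" using in_closed_iff_infdist_zero[OF A(1,2)] by auto
  have "\<exists>e>0. measure \<nu> {y. infdist y A \<le> e} < measure \<nu> {y. infdist y A = 0} + \<alpha> / (4 * m)"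
    by (rule measure_sublevel) (use \<alpha> m in \<open>auto intro!: continuous_intros simp: infdist_nonneg\<close>)
  then obtain e where e: "e > 0" "measure \<nu> {y. infdist y A \<le> e} < measure \<nu> A + \<alpha> / (4 * m)"
    unfolding A0 by (elim exE conjE)
  \<comment> \<open>Half of \<open>\<eta>\<close> keeps a ball about each \<open>b\<close> inside
    the image of \<open>V \<sigma>\<close>. The factor 12 lets three errors of size
    \<open>\<theta>\<close> (from the base point to \<open>b\<close>, and two from \<open>b\<close>
    to the image of the hitting point) sum to at most \<open>e/4\<close>.\<close>
  define \<theta> where "\<theta> = min (\<eta> / 2) (e / 12)"
  have \<theta>: "\<theta> > 0" "\<theta> \<le> \<eta> / 2" "3 * \<theta> \<le> e / 4" using \<eta>(1) e(1) by (auto simp: \<theta>_def)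
  obtain \<epsilon> where \<epsilon>: "\<epsilon> > 0" "\<forall>y y'. dist y y' < \<epsilon> \<longrightarrow> rho y y' < \<theta>" using rho_uniform[OF \<theta>(1)] by (elim exE conjE)
  let ?S = "{g. \<forall>\<sigma>\<in>?\<Sigma> J. infdist (act' g (z \<sigma>)) A < \<epsilon>}"
  have "infinite ?S"
  proof
    assume "finite ?S"
    moreover have "infinite (UNIV :: 'g set)" using tds by (simp add: tds_def)
    ultimately have "(\<lambda>n. favg (F n) (indicator ?S)) \<longlonglongrightarrow> 0" by (intro folner_finite_null F)
    then have "eventually (\<lambda>n. favg (F n) (indicator ?S) < \<alpha>) sequentially"
      using \<alpha> by (rule order_tendstoD)
    moreover have "eventually (\<lambda>n. \<alpha> \<le> favg (F n) (indicator ?S)) sequentially"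
      using dens \<epsilon>(1) by simp
    ultimately have "eventually (\<lambda>n. False) sequentially" by eventually_elim simp
    then show False by simp
  qed
  \<comment> \<open>One element more than in \<open>J\<close>: the translation \<open>t\<close>
    found below is not controlled, and some element of the right translate of \<open>H\<close> must
    fall outside \<open>J\<close>.\<close>
  then obtain H where H: "finite H" "card H = Suc (card J)" "H \<subseteq> ?S"
    using infinite_arbitrarily_large by blast
  have "\<exists>b. rho (z \<sigma>) b < \<theta> \<and> act' g b \<in> A" if "g \<in> H" "\<sigma> \<in> ?\<Sigma> J" for g \<sigma>
  proof -
    have "infdist (act' g (z \<sigma>)) A < \<epsilon>" using H(3) that by blast
    then have "\<exists>a\<in>A. dist (act' g (z \<sigma>)) a < \<epsilon>"
      using A(2) by (simp add: infdist_notempty cINF_less_iff)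
    then obtain a where a: "a \<in> A" "dist (act' g (z \<sigma>)) a < \<epsilon>" by (elim bexE)
    have "rho (z \<sigma>) (act' (- g) a) = rho (act' g (z \<sigma>)) a"
      using rho_act[of g "z \<sigma>" "act' (- g) a"] by simp
    also have "\<dots> < \<theta>" using \<epsilon>(2) a(2) by simp
    finally show ?thesis using a(1) by (intro exI[of _ "act' (- g) a"]) simp
  qed
  then have "\<forall>q. \<exists>b. fst q \<in> H \<longrightarrow> snd q \<in> ?\<Sigma> J \<longrightarrow> rho (z (snd q)) b < \<theta> \<and> act' (fst q) b \<in> A" by blast
  from choice[OF this] obtain b where
    b: "\<forall>q. fst q \<in> H \<longrightarrow> snd q \<in> ?\<Sigma> J \<longrightarrow> rho (z (snd q)) (b q) < \<theta> \<and> act' (fst q) (b q) \<in> A" by (elim exE)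
  have b1: "rho (z \<sigma>) (b (g, \<sigma>)) < \<theta>" and b2: "act' g (b (g, \<sigma>)) \<in> A"
    if "g \<in> H" "\<sigma> \<in> ?\<Sigma> J" for g \<sigma>
    using spec[OF b, of "(g, \<sigma>)"] that by simp_all
  define T where "T = (\<lambda>((g, \<sigma>), k). (V \<sigma>, b (g, \<sigma>), act g -` U k \<inter> \<pi> -` {y. rho (b (g, \<sigma>)) y < \<theta>})) `
     ((H \<times> ?\<Sigma> J) \<times> {..<K})"
  have finT: "finite T" using H(1) fin\<Sigma>[OF J] by (simp add: T_def)
  have "\<exists>t. (\<forall>c\<in>b ` (H \<times> ?\<Sigma> J). rho (act' t c) c < \<theta>) \<and> (\<forall>(V, z, U)\<in>T. act t ` V \<inter> U \<noteq> {})"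
  proof (rule simultaneous_hitting[where \<eta> = "\<eta>/2", OF finT])
    show "finite (b ` (H \<times> ?\<Sigma> J))" using H(1) fin\<Sigma>[OF J] by simp
    show "0 < \<eta>/2" "0 < \<theta>" using \<eta>(1) \<theta>(1) by simp_all
    fix V' z' U' assume "(V', z', U') \<in> T"
    then obtain g \<sigma> k where gk: "g \<in> H" "\<sigma> \<in> ?\<Sigma> J" "k < K" "V' = V \<sigma>" "z' = b (g, \<sigma>)"
      "U' = act g -` U k \<inter> \<pi> -` {y. rho (b (g, \<sigma>)) y < \<theta>}" unfolding T_def by auto
    have "z' \<in> b ` (H \<times> ?\<Sigma> J)" using gk by blast
    moreover have "open V'" using bspec[OF V gk(2)] gk(4) by simp
    moreover have "{y. rho z' y < \<eta>/2} \<subseteq> \<pi> ` V'"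
    proof -
      have "rho (z \<sigma>) y < \<eta>" if "rho z' y < \<eta>/2" for y
        using that b1[OF gk(1,2)] rho_triangle[of "z \<sigma>" y z'] \<theta>(2) gk(5) by simp
      then have "{y. rho z' y < \<eta>/2} \<subseteq> {y. rho (z \<sigma>) y < \<eta>}" by blast
      then show ?thesis using bspec[OF \<eta>(2) gk(2)] gk(4) by simp
    qed
    moreover have "open U'"
      unfolding gk(6) by (intro open_Int open_vimage_act[OF U[OF gk(3)]] open_vimage_pi[OF open_rho_ball])
    moreover have "\<exists>x\<in>U'. \<pi> x = z'"
    proof -
      have "act' g z' \<in> \<pi> ` U k" using subsetD[OF A(3) b2[OF gk(1,2)]] gk(3,5) by (simp add: common_image_def)
      then obtain x where x: "x \<in> U k" "\<pi> x = act' g z'" by auto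
      have "act (- g) x \<in> U'" using x \<theta>(1) gk(5,6) by (simp add: pi_act)
      moreover have "\<pi> (act (- g) x) = z'" using x by (simp add: pi_act)
      ultimately show ?thesis by blast
    qed
    ultimately show "z' \<in> b ` (H \<times> ?\<Sigma> J) \<and> open V' \<and> {y. rho z' y < \<eta>/2} \<subseteq> \<pi> ` V' \<and> open U' \<and> (\<exists>x\<in>U'. \<pi> x = z')"
      by blast
  qed
  then obtain t where t1: "\<forall>c\<in>b ` (H \<times> ?\<Sigma> J). rho (act' t c) c < \<theta>"
    and t2: "\<forall>(V, z, U)\<in>T. act t ` V \<inter> U \<noteq> {}" by (elim exE conjE)
  have "\<not> (\<lambda>g. g + t) ` H \<subseteq> J"
  proof
    assume "(\<lambda>g. g + t) ` H \<subseteq> J"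
    then have "card ((\<lambda>g. g + t) ` H) \<le> card J" using J by (rule card_mono[rotated])
    moreover have "card ((\<lambda>g. g + t) ` H) = card H" by (rule card_image) (simp add: inj_on_def)
    ultimately show False using H(2) by simp
  qed
  then obtain g where g: "g \<in> H" "g + t \<notin> J" by blast
  define h where "h = g + t"
  \<comment> \<open>The last factor confines the image to the \<open>e/4\<close>-ball about the old
    base point. The new base point is supplied by semi-openness somewhere in this image, and
    \<open>e/4 + e/4\<close> is the closeness to \<open>A\<close> needed to refine the
    density.\<close>
  define V' where "V' \<sigma> = V (restrict \<sigma> J) \<inter> act h -` U (\<sigma> h) \<inter> \<pi> -` {y. rho (z (restrict \<sigma> J)) y < e / 4}" for \<sigma>
  have res: "restrict \<sigma> J \<in> ?\<Sigma> J" "\<sigma> h < K" if "\<sigma> \<in> ?\<Sigma> (insert h J)" for \<sigma>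
    using that by (auto simp: PiE_iff)
  have V'_open: "open (V' \<sigma>)" and V'_ne: "V' \<sigma> \<noteq> {}" if \<sigma>: "\<sigma> \<in> ?\<Sigma> (insert h J)" for \<sigma>
  proof -
    let ?s = "restrict \<sigma> J" let ?k = "\<sigma> h" let ?c = "b (g, ?s)"
    note s = res[OF \<sigma>]
    show "open (V' \<sigma>)"
      unfolding V'_def using bspec[OF V s(1)]
      by (intro open_Int open_vimage_act[OF U[OF s(2)]] open_vimage_pi[OF open_rho_ball]) simp
    have "((g, ?s), ?k) \<in> (H \<times> ?\<Sigma> J) \<times> {..<K}" using g(1) s by simp
    then have inT: "(V ?s, ?c, act g -` U ?k \<inter> \<pi> -` {y. rho ?c y < \<theta>}) \<in> T"
      unfolding T_def by (rule rev_image_eqI) simp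
    have "act t ` V ?s \<inter> (act g -` U ?k \<inter> \<pi> -` {y. rho ?c y < \<theta>}) \<noteq> {}" using bspec[OF t2 inT] by simp
    then obtain v where v: "v \<in> V ?s" "act g (act t v) \<in> U ?k" "rho ?c (act' t (\<pi> v)) < \<theta>"
      by (auto simp: pi_act)
    have "?c \<in> b ` (H \<times> ?\<Sigma> J)" using g(1) s(1) by blast
    then have "rho (act' t ?c) ?c < \<theta>" by (rule bspec[OF t1])
    then have "rho ?c (\<pi> v) < 2 * \<theta>"
      using v(3) rho_triangle[of "act' t ?c" "act' t (\<pi> v)" ?c] by simp
    then have "rho (z ?s) (\<pi> v) < e / 4"
      using b1[OF g(1) s(1)] rho_triangle[of "z ?s" "\<pi> v" ?c] \<theta>(3) by linarith
    then have "v \<in> V' \<sigma>" using v by (simp add: V'_def h_def act_add)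
    then show "V' \<sigma> \<noteq> {}" by blast
  qed
  have "\<forall>\<sigma>. \<exists>c. \<sigma> \<in> ?\<Sigma> (insert h J) \<longrightarrow> (\<exists>\<eta>>0. {y. rho c y < \<eta>} \<subseteq> \<pi> ` V' \<sigma>)"
    using image_open_contains_rho_ball[OF V'_open V'_ne] by blast
  from choice[OF this] obtain z' where
    z': "\<forall>\<sigma>. \<sigma> \<in> ?\<Sigma> (insert h J) \<longrightarrow> (\<exists>\<eta>>0. {y. rho (z' \<sigma>) y < \<eta>} \<subseteq> \<pi> ` V' \<sigma>)" by (elim exE)
  have z'near: "rho (z (restrict \<sigma> J)) (z' \<sigma>) < e / 4" if \<sigma>: "\<sigma> \<in> ?\<Sigma> (insert h J)" for \<sigma>
  proof -
    obtain \<eta>' where "\<eta>' > 0" and sub: "{y. rho (z' \<sigma>) y < \<eta>'} \<subseteq> \<pi> ` V' \<sigma>"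
      using spec[OF z', of \<sigma>] \<sigma> by auto
    then have "z' \<sigma> \<in> \<pi> ` V' \<sigma>" by (intro subsetD[OF sub]) simp
    then show ?thesis by (auto simp: V'_def)
  qed
  have card\<Sigma>: "card (?\<Sigma> (insert h J)) = K ^ Suc (card J)"
    using J g(2) by (simp add: card_PiE h_def)
  have dens': "eventually (\<lambda>n. \<alpha> / 2 \<le> favg (F n)
      (indicator {g. \<forall>\<sigma>\<in>?\<Sigma> (insert h J). infdist (act' g (z' \<sigma>)) A < \<epsilon>'})) sequentially" if \<epsilon>': "\<epsilon>' > 0" for \<epsilon>'
  proof (rule density_refine[OF F A(1,2) fin\<Sigma> e(1) _ \<alpha> _ _ \<epsilon>'])
    show "finite (insert h J)" using J by simp
    have "measure \<nu> A \<le> measure \<nu> {y. infdist y A \<le> e}"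
    proof (rule finite_measure_mono)
      show "A \<subseteq> {y. infdist y A \<le> e}" using e(1) by auto
      show "{y. infdist y A \<le> e} \<in> sets \<nu>"
        by (auto intro!: borel_closed closed_Collect_le continuous_intros)
    qed
    then have "real (card (?\<Sigma> (insert h J))) * (measure \<nu> {y. infdist y A \<le> e} - measure \<nu> A)
        \<le> m * (\<alpha> / (4 * m))"
      using e(2) m by (intro mult_mono) (auto simp: card\<Sigma> m_def)
    also have "\<dots> = \<alpha> / 4" using m by simp
    finally show "real (card (?\<Sigma> (insert h J))) * (measure \<nu> {y. infdist y A \<le> e} - measure \<nu> A) \<le> \<alpha> / 4" .
    show "eventually (\<lambda>n. \<alpha> \<le> favg (F n) (indicator {g. \<forall>\<sigma>\<in>?\<Sigma> J. infdist (act' g (z \<sigma>)) A < e / 4})) sequentially"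
      by (rule dens[rule_format]) (use e(1) in simp)
    fix g' \<sigma> assume "g' \<in> {g. \<forall>\<sigma>\<in>?\<Sigma> J. infdist (act' g (z \<sigma>)) A < e / 4}" and \<sigma>: "\<sigma> \<in> ?\<Sigma> (insert h J)"
    then have "infdist (act' g' (z (restrict \<sigma> J))) A < e / 4" using res(1)[OF \<sigma>] by blast
    moreover have "infdist (act' g' (z' \<sigma>)) A \<le> infdist (act' g' (z (restrict \<sigma> J))) A + rho (z (restrict \<sigma> J)) (z' \<sigma>)"
      using infdist_rho_le[of "act' g' (z' \<sigma>)" A "act' g' (z (restrict \<sigma> J))"] by (simp add: rho_commute)
    ultimately show "infdist (act' g' (z' \<sigma>)) A < e / 2" using z'near[OF \<sigma>] by linarith
  qed
  have "open (V' \<sigma>) \<and> (\<exists>\<eta>>0. {y. rho (z' \<sigma>) y < \<eta>} \<subseteq> \<pi> ` V' \<sigma>) \<and>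
        (\<forall>g\<in>insert h J. V' \<sigma> \<subseteq> act g -` U (\<sigma> g))" if \<sigma>: "\<sigma> \<in> ?\<Sigma> (insert h J)" for \<sigma>
  proof (intro conjI ballI)
    show "open (V' \<sigma>)" by (rule V'_open[OF \<sigma>])
    show "\<exists>\<eta>>0. {y. rho (z' \<sigma>) y < \<eta>} \<subseteq> \<pi> ` V' \<sigma>" using spec[OF z', of \<sigma>] \<sigma> by simp
    fix g' assume "g' \<in> insert h J"
    then show "V' \<sigma> \<subseteq> act g' -` U (\<sigma> g')"
    proof
      assume "g' = h"
      then show ?thesis by (auto simp: V'_def)
    next
      assume g': "g' \<in> J"
      have "V (restrict \<sigma> J) \<subseteq> act g' -` U (restrict \<sigma> J g')"
        using bspec[OF V res(1)[OF \<sigma>]] g' by simp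
      then show ?thesis using g' by (auto simp: V'_def)
    qed
  qed
  then have "indep_state F A K U (insert h J)"
    unfolding indep_state_def using dens' \<alpha>
    by (intro exI[of _ V'] exI[of _ z'] exI[of _ "\<alpha> / 2"]) simp
  then show ?thesis using g(2) unfolding h_def by blast
qed

text \<open>Dependent choice yields an increasing chain of stages, all with respect to one Folner
  sequence; the density may shrink but stays positive. A finite subset of the union lies in a single
  stage.\<close>

lemma infinite_independence_set:
  assumes A: "closed A" "A \<subseteq> common_image K U" "0 < measure \<nu> A" and U: "\<And>k. k < K \<Longrightarrow> open (U k)"
    and K: "K > 0"
  shows "\<exists>J. infinite J \<and> independence_set act K U J"
proof -
  obtain F :: "nat \<Rightarrow> 'g set" where F: "folner F" using amenable by (auto simp: amenable_def)
  have ne: "A \<noteq> {}" using A(3) by auto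
  have "\<exists>Js. \<forall>n. (finite (Js n) \<and> card (Js n) = n \<and> indep_state F A K U (Js n)) \<and> Js n \<subseteq> Js (Suc n)"
  proof (rule dependent_nat_choice)
    show "\<exists>J. finite J \<and> card J = 0 \<and> indep_state F A K U J"
      using indep_state_empty[OF F A(1,3)] by (intro exI[of _ "{}"]) simp
    fix J n assume J: "finite J \<and> card J = n \<and> indep_state F A K U J"
    then obtain g where "g \<notin> J" "indep_state F A K U (insert g J)"
      using indep_state_step[OF F A(1) ne A(2) U, of J] by blast
    then show "\<exists>J'. (finite J' \<and> card J' = Suc n \<and> indep_state F A K U J') \<and> J \<subseteq> J'"
      using J by (intro exI[of _ "insert g J"]) auto
  qed
  then obtain Js where Js: "\<And>n. finite (Js n)" "\<And>n. card (Js n) = n" "\<And>n. indep_state F A K U (Js n)"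
    "\<And>n. Js n \<subseteq> Js (Suc n)" by auto
  have mono: "Js n \<subseteq> Js m" if "n \<le> m" for n m using Js(4) that by (rule lift_Suc_mono_le)
  define J where "J = (\<Union>n. Js n)"
  have "infinite J"
  proof
    assume "finite J"
    then have "card (Js (Suc (card J))) \<le> card J" by (intro card_mono) (auto simp: J_def)
    then show False using Js(2) by simp
  qed
  moreover have "independence_set act K U J"
    unfolding independence_set_def
  proof (intro allI impI)
    fix I \<sigma> assume I: "I \<subseteq> J \<and> finite I \<and> I \<noteq> {} \<and> (\<forall>g\<in>I. \<sigma> g < K)"
    have "\<exists>n. I \<subseteq> Js n"
    proof -
      have "\<forall>g\<in>I. \<exists>n. g \<in> Js n" using I by (auto simp: J_def)
      from bchoice[OF this] obtain k where k: "\<forall>g\<in>I. g \<in> Js (k g)" by (elim exE)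
      have "g \<in> Js (Max (k ` I))" if "g \<in> I" for g
        using bspec[OF k that] mono[of "k g" "Max (k ` I)"] I that by auto
      then show ?thesis by blast
    qed
    then obtain n where n: "I \<subseteq> Js n" ..
    \<comment> \<open>The pattern on \<open>I\<close> is extended to the whole stage by the symbol
      0, which is admissible as \<open>K > 0\<close>.\<close>
    define \<tau> where "\<tau> = (\<lambda>g\<in>Js n. if g \<in> I then \<sigma> g else 0)"
    have \<tau>: "\<tau> \<in> PiE (Js n) (\<lambda>_. {..<K})" using I K by (auto simp: \<tau>_def)
    obtain V :: "('g \<Rightarrow> nat) \<Rightarrow> 'x set" and z :: "('g \<Rightarrow> nat) \<Rightarrow> 'y"
      where V: "\<forall>\<sigma>\<in>PiE (Js n) (\<lambda>_. {..<K}). open (V \<sigma>) \<and> (\<exists>\<eta>>0. {y. rho (z \<sigma>) y < \<eta>} \<subseteq> \<pi> ` V \<sigma>) \<and>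
        (\<forall>g\<in>Js n. V \<sigma> \<subseteq> act g -` U (\<sigma> g))"
      using Js(3)[of n] unfolding indep_state_def by (elim exE conjE)
    obtain \<eta> where "\<eta> > 0" and sub: "{y. rho (z \<tau>) y < \<eta>} \<subseteq> \<pi> ` V \<tau>" using bspec[OF V \<tau>] by auto
    then have "z \<tau> \<in> \<pi> ` V \<tau>" by (intro subsetD[OF sub]) simp
    then obtain x where x: "x \<in> V \<tau>" by blast
    have "x \<in> act g -` U (\<sigma> g)" if "g \<in> I" for g
    proof -
      have "g \<in> Js n" using n that by blast
      then have "V \<tau> \<subseteq> act g -` U (\<tau> g)" using bspec[OF V \<tau>] by simp
      moreover have "\<tau> g = \<sigma> g" using \<open>g \<in> Js n\<close> that by (simp add: \<tau>_def)
      ultimately show ?thesis using x by auto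
    qed
    then show "(\<Inter>g\<in>I. act g -` U (\<sigma> g)) \<noteq> {}" by blast
  qed
  ultimately show ?thesis by blast
qed

text \<open>Balls whose closures lie in the \<open>U k\<close> have a closed common image of
  positive measure inside that of the \<open>U k\<close>, as the construction of the independence
  set requires.\<close>

lemma wms_tuple_imp_IT_tuple:
  assumes wms: "wms_tuple act K xs"
  shows "IT_tuple act K xs"
  unfolding IT_tuple_def
proof (intro allI impI)
  fix U assume U: "\<forall>k<K. open (U k) \<and> xs k \<in> U k"
  show "\<exists>J. infinite J \<and> independence_set act K U J"
  proof (cases "K = 0")
    \<comment> \<open>With no symbols there is no pattern on a nonempty set, so the whole group is
      independent.\<close>
    case True
    have "infinite (UNIV :: 'g set)" using tds by (simp add: tds_def)
    then show ?thesis using True by (intro exI[of _ UNIV]) (auto simp: independence_set_def)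
  next
    case False
    have "\<exists>r>0. k < K \<longrightarrow> cball (xs k) r \<subseteq> U k" for k
      using U open_contains_cball[of "U k"] by (cases "k < K") (auto intro: exI[of _ 1])
    then have "\<forall>k. \<exists>r>0. k < K \<longrightarrow> cball (xs k) r \<subseteq> U k" by (rule allI)
    from choice[OF this] obtain r where r: "\<forall>k. r k > 0 \<and> (k < K \<longrightarrow> cball (xs k) (r k) \<subseteq> U k)" by (elim exE)
    let ?B = "\<lambda>k. ball (xs k) (r k)"
    have pos: "0 < measure \<nu> (common_image K (\<lambda>k. closure (?B k)))"
      using r by (intro wms_tuple_common_image_pos[OF wms]) auto
    have "closure (?B k) \<subseteq> U k" if "k < K" for k
      using closure_mono[OF ball_subset_cball, of "xs k" "r k"] r that by (auto simp: closure_closed)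
    then have "common_image K (\<lambda>k. closure (?B k)) \<subseteq> common_image K U"
      unfolding common_image_def by blast
    then show ?thesis
      using U False by (intro infinite_independence_set[OF closed_common_image _ pos]) auto
  qed
qed

end

theorem theorem1p6:
  fixes act :: "'g::group_add \<Rightarrow> 'x::metric_space \<Rightarrow> 'x"
    and act' :: "'g \<Rightarrow> 'y::metric_space \<Rightarrow> 'y"
    and \<pi> :: "'x \<Rightarrow> 'y"
    and \<nu> :: "'y measure"
  assumes "tds act" and "minimal_system act" and "amenable TYPE('g)"
    and "local_Bronstein act"
    and "max_eq_factor act act' \<pi>"
    and "invariant_prob act' \<nu>"
  shows "(\<exists>Z. gdelta_in euclidean Z \<and> closure Z = UNIV \<and> Z \<in> sets \<nu> \<and> emeasure \<nu> Z = 1 \<and>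
            (\<forall>y\<in>Z. wms_set act (\<pi> -` {y})))
       \<and> (\<forall>K::nat. regular_K_to_one \<pi> \<nu> K \<longrightarrow>
            (\<exists>xs. essential K xs \<and> wms_tuple act K xs) \<and>
            \<not> (\<exists>xs. essential (K + 1) xs \<and> wms_tuple act (K + 1) xs))
       \<and> (\<forall>A. A \<noteq> {} \<and> wms_set act A \<longrightarrow> IT_set act A)"
proof -
  interpret mef_measure act act' \<pi> \<nu>
    by unfold_locales (fact assms)+
  show ?thesis
  proof (intro conjI allI impI)
    fix K assume "regular_K_to_one \<pi> \<nu> K"
    then show "\<exists>xs. essential K xs \<and> wms_tuple act K xs"
      "\<not> (\<exists>xs. essential (K + 1) xs \<and> wms_tuple act (K + 1) xs)"
      by (fact essential_wms_tuples)+
  next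
    fix A assume "A \<noteq> {} \<and> wms_set act A"
    then show "IT_set act A"
      unfolding wms_set_def IT_set_def using wms_tuple_imp_IT_tuple by simp
  qed (fact wms_fibres)
qed

end
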